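(* Let $n=5$, so that $\dim V=10$, and let $E=C^{10}\oplus C^2\oplus S$, a $k$-vector space of dimension $78$. Let $[\ ,\ ]:E\times E\to E$ be the unique antisymmetric bilinear map such that $[A,B']=AB'-B'A$ for $A,B'\in C^2\oplus C^{10}$; $[A,\psi]=A\cdot\psi$ for $A\in C^2\oplus C^{10}$, $\psi\in S$; and $[\psi_1,\psi_2]=2\tilde L_2(\psi_1,\psi_2)+96L_{10}(\psi_1,\psi_2)$ for $\psi_1,\psi_2\in S$. Then $(E,[\ ,\ ])$ is a simple Lie algebra.
   Context: $k$ is a field of characteristic not $2$ or $3$; $V$ is a $2n$-dimensional $k$-vector space with a nondegenerate symmetric bilinear form $g$ of Witt index $n$ (hyperbolic). $C=C(V,g)$ is the Clifford algebra, $vw+wv=2g(v,w)1$ for $v,w\in V\subset C$. $S$ is a fixed $2^n$-dimensional $k$-vector space (spinors) with an algebra isomorphism $C\cong End(S)$; $c\cdot\psi$ denotes the action of $c\in C$ on $\psi\in S$. A spinor norm is a bilinear map $B:S\times S\to k$ with $B(v\cdot\phi,\psi)=B(\phi,v\cdot\psi)$ for all $v\in V$, $\phi,\psi\in S$; a nondegenerate spinor norm $B$ is fixed. An orthonormal basis of $V$ is a basis $x_1,\dots,x_{2n}$ with $g(x_i,x_j)=\pm\delta_{ij}$. $C^m\subset C$ is the span of the products $x_{i_1}\cdots x_{i_m}$, $i_1<\dots<i_m$ (independent of the choice of orthonormal basis); $C^2$ and $C^2\oplus C^{2n}$ are Lie algebras under commutator. For any orthonormal basis (independently of the choice), $\tilde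 L_2:S\times S\to C^2$ and $L_{2n}:S\times S\to C^{2n}$ are $$\tilde L_2(\phi,\psi)=\frac12\sum_{i<j}g(x_i,x_i)g(x_j,x_j)B(\phi,x_jx_i\cdot\psi)\,x_ix_j,$$ $$L_{2n}(\phi,\psi)=\frac1{2^n}g(x_1,x_1)\cdots g(x_{2n},x_{2n})B(\phi,x_{2n}\cdots x_1\cdot\psi)\,x_1\cdots x_{2n}.$$ For $n=5$ both are antisymmetric. *)

theory Defs
  imports "HOL-Analysis.Product_Vector" "HOL-Library.Poly_Mapping"
begin

text \<open>
  Vector spaces over the field \<open>'k\<close> are types with a scalar multiplication satisfying
  \<^const>\<open>vector_space\<close>; subspaces, spans, dimensions and linear maps are those of the library.
\<close>

section \<open>Bilinear forms\<close>

definition bilinear_map ::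
  "('k::field \<Rightarrow> 'u::ab_group_add \<Rightarrow> 'u) \<Rightarrow> ('k \<Rightarrow> 'v::ab_group_add \<Rightarrow> 'v) \<Rightarrow>
   ('k \<Rightarrow> 'w::ab_group_add \<Rightarrow> 'w) \<Rightarrow> ('u \<Rightarrow> 'v \<Rightarrow> 'w) \<Rightarrow> bool" where
  "bilinear_map sU sV sW f \<longleftrightarrow>
     (\<forall>u. Vector_Spaces.linear sV sW (f u)) \<and> (\<forall>v. Vector_Spaces.linear sU sW (\<lambda>u. f u v))"

definition nondegenerate :: "('v::zero \<Rightarrow> 'v \<Rightarrow> 'k::zero) \<Rightarrow> bool" where
  "nondegenerate b \<longleftrightarrow>
     (\<forall>v. (\<forall>w. b v w = 0) \<longrightarrow> v = 0) \<and> (\<forall>w. (\<forall>v. b v w = 0) \<longrightarrow> w = 0)"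

definition witt_index ::
  "('k::field \<Rightarrow> 'v::ab_group_add \<Rightarrow> 'v) \<Rightarrow> ('v \<Rightarrow> 'v \<Rightarrow> 'k) \<Rightarrow> nat" where
  "witt_index sV g =
     Max {vector_space.dim sV W |W. module.subspace sV W \<and> (\<forall>v\<in>W. \<forall>w\<in>W. g v w = 0)}"

definition orthonormal_basis ::
  "('k::field \<Rightarrow> 'v::ab_group_add \<Rightarrow> 'v) \<Rightarrow> ('v \<Rightarrow> 'v \<Rightarrow> 'k) \<Rightarrow> nat \<Rightarrow> (nat \<Rightarrow> 'v) \<Rightarrow> bool" where
  "orthonormal_basis sV g N x \<longleftrightarrow>
     inj_on x {1..N} \<and> \<not> module.dependent sV (x ` {1..N}) \<and> module.span sV (x ` {1..N}) = UNIV \<and>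
     (\<forall>i\<in>{1..N}. g (x i) (x i) = 1 \<or> g (x i) (x i) = - 1) \<and>
     (\<forall>i\<in>{1..N}. \<forall>j\<in>{1..N}. i \<noteq> j \<longrightarrow> g (x i) (x j) = 0)"

section \<open>Clifford algebras\<close>

definition assoc_algebra :: "('k::field \<Rightarrow> 'c::ring_1 \<Rightarrow> 'c) \<Rightarrow> bool" where
  "assoc_algebra sC \<longleftrightarrow> vector_space sC \<and>
     (\<forall>a x y. sC a (x * y) = sC a x * y) \<and> (\<forall>a x y. sC a (x * y) = x * sC a y)"

text \<open>
  The monoid algebra \<open>'v free_monoid \<Rightarrow>\<^sub>0 'k\<close> is the free unital associative
  \<open>'k\<close>-algebra on the set \<open>'v\<close>. The monoid is written additively because that is what
  the convolution product on \<^type>\<open>poly_mapping\<close> expects.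
\<close>

datatype 'v free_monoid = Word (letters: "'v list")

instantiation free_monoid :: (type) monoid_add
begin

definition zero_free_monoid :: "'a free_monoid" where
  "zero_free_monoid = Word []"

definition plus_free_monoid :: "'a free_monoid \<Rightarrow> 'a free_monoid \<Rightarrow> 'a free_monoid" where
  "plus_free_monoid u v = Word (letters u @ letters v)"

instance
  by standard (simp_all add: zero_free_monoid_def plus_free_monoid_def)

end

definition free_gen :: "'v \<Rightarrow> ('v free_monoid \<Rightarrow>\<^sub>0 'k::field)" where
  "free_gen v = Poly_Mapping.single (Word [v]) 1"

definition free_const :: "'k::field \<Rightarrow> ('v free_monoid \<Rightarrow>\<^sub>0 'k)" where
  "free_const a = Poly_Mapping.single 0 a"

definition free_eval ::
  "('k::field \<Rightarrow> 'c::ring_1 \<Rightarrow> 'c) \<Rightarrow> ('v \<Rightarrow> 'c) \<Rightarrow> ('v free_monoid \<Rightarrow>\<^sub>0 'k) \<Rightarrow> 'c" where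
  "free_eval sC \<iota> p =
     (\<Sum>w\<in>Poly_Mapping.keys p. sC (Poly_Mapping.lookup p w) (prod_list (map \<iota> (letters w))))"

definition two_sided_ideal :: "'a::ring_1 set \<Rightarrow> bool" where
  "two_sided_ideal I \<longleftrightarrow> 0 \<in> I \<and> (\<forall>x\<in>I. \<forall>y\<in>I. x + y \<in> I) \<and>
     (\<forall>a. \<forall>x\<in>I. a * x \<in> I \<and> x * a \<in> I)"

text \<open>
  The first two families of relations cut the free algebra on the set \<open>'v\<close> down to the tensor
  algebra of the vector space; the third is the Clifford relation.
\<close>

definition clifford_relations ::
  "('k::field \<Rightarrow> 'v::ab_group_add \<Rightarrow> 'v) \<Rightarrow> ('v \<Rightarrow> 'v \<Rightarrow> 'k) \<Rightarrow> ('v free_monoid \<Rightarrow>\<^sub>0 'k) set" where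
  "clifford_relations sV g =
     {free_gen (v + w) - free_gen v - free_gen w |v w. True} \<union>
     {free_gen (sV a v) - free_const a * free_gen v |a v. True} \<union>
     {free_gen v * free_gen w + free_gen w * free_gen v - free_const (2 * g v w) |v w. True}"

text \<open>
  \<open>(C, \<iota>)\<close> is the Clifford algebra of \<open>(V, g)\<close>, i.e. (up to the canonical isomorphism) the tensor
  algebra modulo the two-sided ideal generated by \<open>vw + wv - 2g(v,w)1\<close>: the algebra map from the
  free algebra extending \<open>\<iota>\<close> is onto and its kernel is exactly the ideal of relations.
\<close>

definition is_clifford_algebra ::
  "('k::field \<Rightarrow> 'v::ab_group_add \<Rightarrow> 'v) \<Rightarrow> ('v \<Rightarrow> 'v \<Rightarrow> 'k) \<Rightarrow>
   ('k \<Rightarrow> 'c::ring_1 \<Rightarrow> 'c) \<Rightarrow> ('v \<Rightarrow> 'c) \<Rightarrow> bool" where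
  "is_clifford_algebra sV g sC \<iota> \<longleftrightarrow> assoc_algebra sC \<and> surj (free_eval sC \<iota>) \<and>
     {p. free_eval sC \<iota> p = 0} = two_sided_ideal hull (clifford_relations sV g)"

definition clifford_grade ::
  "('k::field \<Rightarrow> 'c::ring_1 \<Rightarrow> 'c) \<Rightarrow> ('v \<Rightarrow> 'c) \<Rightarrow> nat \<Rightarrow> (nat \<Rightarrow> 'v) \<Rightarrow> nat \<Rightarrow> 'c set" where
  "clifford_grade sC \<iota> n x m =
     module.span sC {prod_list (map (\<lambda>i. \<iota> (x i)) (sorted_list_of_set I)) |I.
                       I \<subseteq> {1..2 * n} \<and> card I = m}"

section \<open>Spinors\<close>

text \<open>\<open>\<rho>\<close> is an algebra isomorphism onto the algebra of linear endomorphisms of \<open>S\<close>.\<close>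

definition End_iso ::
  "('k::field \<Rightarrow> 'c::ring_1 \<Rightarrow> 'c) \<Rightarrow> ('k \<Rightarrow> 's::ab_group_add \<Rightarrow> 's) \<Rightarrow> ('c \<Rightarrow> 's \<Rightarrow> 's) \<Rightarrow> bool" where
  "End_iso sC sS \<rho> \<longleftrightarrow>
     bij_betw \<rho> UNIV {f. Vector_Spaces.linear sS sS f} \<and>
     (\<forall>c d \<psi>. \<rho> (c + d) \<psi> = \<rho> c \<psi> + \<rho> d \<psi>) \<and>
     (\<forall>a c \<psi>. \<rho> (sC a c) \<psi> = sS a (\<rho> c \<psi>)) \<and>
     (\<forall>c d. \<rho> (c * d) = \<rho> c \<circ> \<rho> d) \<and> \<rho> 1 = id"

definition spinor_norm ::
  "('k::field \<Rightarrow> 's::ab_group_add \<Rightarrow> 's) \<Rightarrow> ('v \<Rightarrow> 'c) \<Rightarrow> ('c \<Rightarrow> 's \<Rightarrow> 's) \<Rightarrow> ('s \<Rightarrow> 's \<Rightarrow> 'k) \<Rightarrow> bool" where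
  "spinor_norm sS \<iota> \<rho> B \<longleftrightarrow> bilinear_map sS sS (*) B \<and>
     (\<forall>v \<phi> \<psi>. B (\<rho> (\<iota> v) \<phi>) \<psi> = B \<phi> (\<rho> (\<iota> v) \<psi>))"

definition L2_tilde ::
  "('v \<Rightarrow> 'v \<Rightarrow> 'k::field) \<Rightarrow> ('k \<Rightarrow> 'c::ring_1 \<Rightarrow> 'c) \<Rightarrow> ('v \<Rightarrow> 'c) \<Rightarrow> ('c \<Rightarrow> 's \<Rightarrow> 's) \<Rightarrow>
   ('s \<Rightarrow> 's \<Rightarrow> 'k) \<Rightarrow> nat \<Rightarrow> (nat \<Rightarrow> 'v) \<Rightarrow> 's \<Rightarrow> 's \<Rightarrow> 'c" where
  "L2_tilde g sC \<iota> \<rho> B n x \<phi> \<psi> =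
     sC (1 / 2) (\<Sum>j\<in>{1..2 * n}. \<Sum>i\<in>{1..<j}.
       sC (g (x i) (x i) * g (x j) (x j) * B \<phi> (\<rho> (\<iota> (x j) * \<iota> (x i)) \<psi>)) (\<iota> (x i) * \<iota> (x j)))"

definition L_top ::
  "('v \<Rightarrow> 'v \<Rightarrow> 'k::field) \<Rightarrow> ('k \<Rightarrow> 'c::ring_1 \<Rightarrow> 'c) \<Rightarrow> ('v \<Rightarrow> 'c) \<Rightarrow> ('c \<Rightarrow> 's \<Rightarrow> 's) \<Rightarrow>
   ('s \<Rightarrow> 's \<Rightarrow> 'k) \<Rightarrow> nat \<Rightarrow> (nat \<Rightarrow> 'v) \<Rightarrow> 's \<Rightarrow> 's \<Rightarrow> 'c" where
  "L_top g sC \<iota> \<rho> B n x \<phi> \<psi> =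
     sC (1 / 2 ^ n * (\<Prod>i\<in>{1..2 * n}. g (x i) (x i)) *
         B \<phi> (\<rho> (prod_list (map (\<lambda>i. \<iota> (x i)) (rev [1..<2 * n + 1]))) \<psi>))
        (prod_list (map (\<lambda>i. \<iota> (x i)) [1..<2 * n + 1]))"

section \<open>Lie algebras\<close>

definition bilinear_on ::
  "('k \<Rightarrow> 'e::plus \<Rightarrow> 'e) \<Rightarrow> 'e set \<Rightarrow> ('e \<Rightarrow> 'e \<Rightarrow> 'e) \<Rightarrow> bool" where
  "bilinear_on s L br \<longleftrightarrow>
     (\<forall>x\<in>L. \<forall>y\<in>L. br x y \<in> L) \<and>
     (\<forall>x\<in>L. \<forall>y\<in>L. \<forall>z\<in>L. br (x + y) z = br x z + br y z \<and> br z (x + y) = br z x + br z y) \<and>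
     (\<forall>a. \<forall>x\<in>L. \<forall>y\<in>L. br (s a x) y = s a (br x y) \<and> br x (s a y) = s a (br x y))"

definition lie_algebra_on ::
  "('k::field \<Rightarrow> 'e::ab_group_add \<Rightarrow> 'e) \<Rightarrow> 'e set \<Rightarrow> ('e \<Rightarrow> 'e \<Rightarrow> 'e) \<Rightarrow> bool" where
  "lie_algebra_on s L br \<longleftrightarrow> vector_space s \<and> module.subspace s L \<and> bilinear_on s L br \<and>
     (\<forall>x\<in>L. br x x = 0) \<and>
     (\<forall>x\<in>L. \<forall>y\<in>L. \<forall>z\<in>L. br x (br y z) + br y (br z x) + br z (br x y) = 0)"

definition lie_ideal_on ::
  "('k::field \<Rightarrow> 'e::ab_group_add \<Rightarrow> 'e) \<Rightarrow> 'e set \<Rightarrow> ('e \<Rightarrow> 'e \<Rightarrow> 'e) \<Rightarrow> 'e set \<Rightarrow> bool" where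
  "lie_ideal_on s L br I \<longleftrightarrow>
     module.subspace s I \<and> I \<subseteq> L \<and> (\<forall>x\<in>L. \<forall>y\<in>I. br x y \<in> I)"

definition simple_lie_algebra_on ::
  "('k::field \<Rightarrow> 'e::ab_group_add \<Rightarrow> 'e) \<Rightarrow> 'e set \<Rightarrow> ('e \<Rightarrow> 'e \<Rightarrow> 'e) \<Rightarrow> bool" where
  "simple_lie_algebra_on s L br \<longleftrightarrow> lie_algebra_on s L br \<and>
     (\<exists>x\<in>L. \<exists>y\<in>L. br x y \<noteq> 0) \<and> (\<forall>I. lie_ideal_on s L br I \<longrightarrow> I = {0} \<or> I = L)"

section \<open>The space \<open>E\<close> and its bracket\<close>

text \<open>
  \<open>C\<^sup>1\<^sup>0 \<oplus> C\<^sup>2\<close> is formed inside \<open>C\<close>, where the sum is direct; \<open>E\<close> is a subspace of \<open>C \<times> S\<close>.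
\<close>

definition C10_plus_C2 ::
  "('k::field \<Rightarrow> 'c::ring_1 \<Rightarrow> 'c) \<Rightarrow> ('v \<Rightarrow> 'c) \<Rightarrow> (nat \<Rightarrow> 'v) \<Rightarrow> 'c set" where
  "C10_plus_C2 sC \<iota> x = {a + b |a b. a \<in> clifford_grade sC \<iota> 5 x 10 \<and> b \<in> clifford_grade sC \<iota> 5 x 2}"

definition E_space ::
  "('k::field \<Rightarrow> 'c::ring_1 \<Rightarrow> 'c) \<Rightarrow> ('v \<Rightarrow> 'c) \<Rightarrow> (nat \<Rightarrow> 'v) \<Rightarrow> ('c \<times> 's) set" where
  "E_space sC \<iota> x = C10_plus_C2 sC \<iota> x \<times> UNIV"

definition is_E_bracket ::
  "('v \<Rightarrow> 'v \<Rightarrow> 'k::field) \<Rightarrow> ('k \<Rightarrow> 'c::ring_1 \<Rightarrow> 'c) \<Rightarrow> ('v \<Rightarrow> 'c) \<Rightarrow>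
   ('k \<Rightarrow> 's::ab_group_add \<Rightarrow> 's) \<Rightarrow> ('c \<Rightarrow> 's \<Rightarrow> 's) \<Rightarrow> ('s \<Rightarrow> 's \<Rightarrow> 'k) \<Rightarrow> (nat \<Rightarrow> 'v) \<Rightarrow>
   ('c \<times> 's \<Rightarrow> 'c \<times> 's \<Rightarrow> 'c \<times> 's) \<Rightarrow> bool" where
  "is_E_bracket g sC \<iota> sS \<rho> B x br \<longleftrightarrow>
     bilinear_on (module_prod.scale sC sS) (E_space sC \<iota> x) br \<and>
     (\<forall>X\<in>E_space sC \<iota> x. \<forall>Y\<in>E_space sC \<iota> x. br X Y = - br Y X) \<and>
     (\<forall>A\<in>C10_plus_C2 sC \<iota> x. \<forall>A'\<in>C10_plus_C2 sC \<iota> x. br (A, 0) (A', 0) = (A * A' - A' * A, 0)) \<and>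
     (\<forall>A\<in>C10_plus_C2 sC \<iota> x. \<forall>\<psi>. br (A, 0) (0, \<psi>) = (0, \<rho> A \<psi>)) \<and>
     (\<forall>\<psi>\<^sub>1 \<psi>\<^sub>2. br (0, \<psi>\<^sub>1) (0, \<psi>\<^sub>2) =
        (sC 2 (L2_tilde g sC \<iota> \<rho> B 5 x \<psi>\<^sub>1 \<psi>\<^sub>2) + sC 96 (L_top g sC \<iota> \<rho> B 5 x \<psi>\<^sub>1 \<psi>\<^sub>2), 0))"

end

theory Submission
  imports Defs
begin

text \<open>
  Write \<open>x\<^sub>i\<close> for the orthonormal basis, \<open>e\<^sub>i = g(x\<^sub>i, x\<^sub>i)\<close>, \<open>\<omega> = x\<^sub>1 \<cdots> x\<^sub>1\<^sub>0\<close> and \<open>L(\<phi>, \<psi>)\<close> for the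
  bracket of two spinors. The bracket on \<open>E\<close> satisfies the Jacobi identity because \<open>C\<close> is associative
  and \<open>S\<close> is a \<open>C\<close>-module, because \<open>L\<close> is equivariant under \<open>C\<^sup>2 \<oplus> C\<^sup>1\<^sup>0\<close>, and because the cyclic sum of
  \<open>L(\<phi>, \<psi>)\<chi>\<close> vanishes. Equivariance (\<open>L_equivariant\<close>) holds since \<open>L\<close> is contracted from two copies of
  the invariant tensor \<open>\<Sum> e\<^sub>i x\<^sub>i \<otimes> x\<^sub>i\<close>. The cyclic sum is the point where the dimension \<open>10\<close> and the
  coefficient \<open>96\<close> matter.

  The cyclic identity is a Fierz identity. As \<open>C = End S\<close>, the operator \<open>\<theta> \<mapsto> h(\<theta>) \<psi>\<close> is an element \<open>a\<close> of
  \<open>C\<close>, and \<open>h(L(\<psi>, \<chi>)\<theta>) = B(\<chi>, R(a)\<theta>)\<close> for an explicit linear operator \<open>R\<close> on \<open>C\<close>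
  (\<open>L_recouple\<close>). A product of \<open>k\<close> different \<open>x\<^sub>i\<close> is an eigenvector of \<open>R\<close> with eigenvalue
  \<open>5 - 2 (5 - k)\<^sup>2 - 3 (- 1)\<^sup>k\<close>, and its adjoint for \<open>B\<close> is \<open>(- 1)\<^bsup>k choose 2\<^esup>\<close> times itself. The
  degrees \<open>3\<close> and \<open>7\<close> are the odd ones in which the adjoint changes the sign, and there the eigenvalue is
  \<open>0\<close>. This says that the cyclic sum vanishes when two of its arguments have the same chirality. Among
  three spinors of pure chirality two always agree; to avoid square roots of \<open>\<omega>\<^sup>2\<close> the argument is
  phrased with \<open>\<omega>\<close> in place of its eigenspaces (\<open>jacobiator_volume\<close>, \<open>jacobiator_zero\<close>).

  All of this presupposes that \<open>B\<close> is symmetric. Uniqueness of the spinor norm makes \<open>B\<close> proportional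
  to its transpose, and the factor is read off from the product of a basis of a maximal isotropic
  subspace, which acts on \<open>S\<close> with rank one (\<open>B_symmetry\<close>).

  For simplicity, a nonzero ideal contains a spinor \<open>\<psi> \<noteq> 0\<close>. If its spinors did not fill \<open>S\<close>, a functional
  \<open>h\<close> vanishing on them would give an operator \<open>a = h(-) \<psi>\<close> with \<open>R(w a) = 0\<close> for every even word
  \<open>w\<close>. The eigenvalues of \<open>R\<close> in the degrees \<open>0\<close> and \<open>1\<close> are \<open>- 48\<close> and \<open>- 24\<close>, which are nonzero in
  characteristic other than \<open>2\<close> and \<open>3\<close>; hence \<open>w a\<close> has no component in these degrees for any even
  \<open>w\<close>, which forces \<open>a = 0\<close> (\<open>eq_0_if_even_recouple_0\<close>). So the ideal contains \<open>S\<close>, and the values of \<open>L\<close> span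
  \<open>C\<^sup>2 \<oplus> C\<^sup>1\<^sup>0\<close> (\<open>L_spans_lie\<close>). The dimension is \<open>45 + 1 + 32\<close>, by independence of the monomials in the
  \<open>x\<^sub>i\<close>.
\<close>

section \<open>Words in an orthonormal frame of a Clifford algebra\<close>

locale clifford_frame = vector_space scale
  for scale :: "'k::field \<Rightarrow> 'c::ring_1 \<Rightarrow> 'c" (infixr "*C" 75) +
  fixes N :: nat and X :: "nat \<Rightarrow> 'c" and e :: "nat \<Rightarrow> 'k"
  assumes scale_mult_left: "(a *C u) * v = a *C (u * v)"
    and scale_mult_right: "u * (a *C v) = a *C (u * v)"
    and X_square: "i \<in> {1..N} \<Longrightarrow> X i * X i = e i *C 1"
    and X_anticomm: "i \<in> {1..N} \<Longrightarrow> j \<in> {1..N} \<Longrightarrow> i \<noteq> j \<Longrightarrow> X i * X j = - (X j * X i)"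
    and e_square: "i \<in> {1..N} \<Longrightarrow> e i * e i = 1"
begin

definition word :: "nat list \<Rightarrow> 'c" where
  "word w = prod_list (map X w)"

text \<open>Reordering a word and cancelling repeated letters changes it only by a sign, so up to sign a word is
  determined by the set of letters that occur in it an odd number of times.\<close>

fun odd_letters :: "nat list \<Rightarrow> nat set" where
  "odd_letters [] = {}"
| "odd_letters (i # w) =
     (if i \<in> odd_letters w then odd_letters w - {i} else insert i (odd_letters w))"

definition swap_sign :: "nat \<Rightarrow> nat set \<Rightarrow> 'k" where
  "swap_sign i K = (- 1) ^ card K * (if i \<in> K then - 1 else 1)"

lemma word_Nil [simp]: "word [] = 1"
  and word_Cons [simp]: "word (i # w) = X i * word w"
  and word_append: "word (v @ w) = word v * word w"
  by (simp_all add: word_def)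

lemma odd_letters_subset: "odd_letters w \<subseteq> set w"
  by (induction w) auto

lemma finite_odd_letters [simp]: "finite (odd_letters w)"
  by (rule finite_subset[OF odd_letters_subset]) simp

lemma odd_letters_append: "odd_letters (v @ w) = sym_diff (odd_letters v) (odd_letters w)"
  by (induction v) auto

lemma odd_letters_distinct: "distinct w \<Longrightarrow> odd_letters w = set w"
  by (induction w) (use odd_letters_subset in auto)

lemma minus_one_card_Cons: "(- 1 :: 'k) ^ card (odd_letters (i # w)) = - ((- 1) ^ card (odd_letters w))"
proof (cases "i \<in> odd_letters w")
  case True
  then obtain m where "card (odd_letters w) = Suc m"
    by (metis card_Suc_Diff1 finite_odd_letters)
  then show ?thesis using True by simp
qed simp

lemma minus_one_card: "(- 1 :: 'k) ^ card (odd_letters w) = (- 1) ^ length w"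
  by (induction w) (use minus_one_card_Cons in auto)

lemma swap_sign_Cons:
  "swap_sign j (odd_letters (i # w)) = (if i = j then 1 else - 1) * swap_sign j (odd_letters w)"
  unfolding swap_sign_def minus_one_card_Cons by auto

lemma swap_sign_cases: "swap_sign i K = 1 \<or> swap_sign i K = - 1"
  by (cases "even (card K)") (auto simp: swap_sign_def)

lemma swap_sign_square [simp]: "swap_sign i K * swap_sign i K = 1"
  by (auto simp: swap_sign_def simp flip: power_add)

lemma X_word:
  assumes "set w \<subseteq> {1..N}" and "i \<in> {1..N}"
  shows "X i * word w = swap_sign i (odd_letters w) *C (word w * X i)"
  using assms(1)
proof (induction w)
  case Nil
  then show ?case by (simp add: swap_sign_def)
next
  case (Cons j w)
  let ?s = "swap_sign i (odd_letters w)"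
  have IH: "X i * word w = ?s *C (word w * X i)" using Cons by simp
  show ?case
  proof (cases "j = i")
    case True
    have "X i * (X i * word w) = ?s *C (X i * (word w * X i))"
      by (simp only: IH scale_mult_right)
    then show ?thesis
      unfolding swap_sign_Cons using True by (simp add: mult.assoc)
  next
    case False
    have "X i * word (j # w) = - (X j * (X i * word w))"
      using X_anticomm[of i j] assms(2) Cons.prems False by (simp flip: mult.assoc)
    also have "\<dots> = (- ?s) *C (word (j # w) * X i)"
      by (simp add: IH scale_mult_right mult.assoc)
    finally show ?thesis unfolding swap_sign_Cons using False by simp
  qed
qed

lemma conj_word:
  assumes "set w \<subseteq> {1..N}" and "i \<in> {1..N}"
  shows "X i * word w * X i = (e i * swap_sign i (odd_letters w)) *C word w"
  unfolding X_word[OF assms]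
  by (simp add: scale_mult_left mult.assoc X_square[OF assms(2)] scale_mult_right mult.commute)

text \<open>Moving the first letter of a word to its end costs its swap sign, and this is the ratio of two
  consecutive values of \<open>(- 1)\<^bsup>k choose 2\<^esup>\<close>.\<close>

lemma word_rev:
  assumes "set w \<subseteq> {1..N}"
  shows "word (rev w) = ((- 1) ^ (card (odd_letters w) choose 2)) *C word w"
  using assms
proof (induction w)
  case Nil
  then show ?case by (simp add: binomial_eq_0)
next
  case (Cons i w)
  let ?K = "odd_letters w"
  have i: "i \<in> {1..N}" and w: "set w \<subseteq> {1..N}" using Cons.prems by auto
  have Xi: "word w * X i = swap_sign i ?K *C (X i * word w)"
    by (simp add: X_word[OF w i])
  have s: "(- 1) ^ (card ?K choose 2) * swap_sign i ?K = (- 1) ^ (card (odd_letters (i # w)) choose 2)"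
  proof (cases "i \<in> ?K")
    case True
    then obtain m where m: "card ?K = Suc m" by (metis card_Suc_Diff1 finite_odd_letters)
    have "(- 1 :: 'k) ^ (Suc m choose 2) = (- 1) ^ m * (- 1) ^ (m choose 2)"
      by (simp add: numeral_2_eq_2 power_add)
    moreover have "(- 1 :: 'k) ^ m * (- 1) ^ m = 1" by (simp flip: power_add)
    ultimately show ?thesis using True m by (simp add: swap_sign_def mult.assoc mult.left_commute)
  next
    case False
    have "(- 1 :: 'k) ^ (Suc (card ?K) choose 2) = (- 1) ^ card ?K * (- 1) ^ (card ?K choose 2)"
      by (simp add: numeral_2_eq_2 power_add)
    then show ?thesis using False by (simp add: swap_sign_def)
  qed
  have "word (rev (i # w)) = word (rev w) * X i" by (simp add: word_append)
  also have "\<dots> = ((- 1) ^ (card ?K choose 2) * swap_sign i ?K) *C word (i # w)"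
    by (simp add: Cons.IH[OF w] scale_mult_left Xi)
  finally show ?case unfolding s .
qed

text \<open>The first letter recurs later. Conjugating the part in between by it costs a sign and leaves a word
  with two letters less.\<close>

lemma word_no_odd_letters:
  assumes "set w \<subseteq> {1..N}" and "odd_letters w = {}"
  shows "word w = 1 \<or> word w = - 1"
  using assms
proof (induction w rule: length_induct)
  case (1 w)
  show ?case
  proof (cases w)
    case Nil
    then show ?thesis by simp
  next
    case (Cons i w')
    have i: "i \<in> {1..N}" "i \<in> odd_letters w'" using 1(2,3) Cons by (auto split: if_splits)
    then obtain u v where uv: "w' = u @ i # v"
      using odd_letters_subset by (metis split_list subsetD)
    have sets: "set u \<subseteq> {1..N}" "set (u @ v) \<subseteq> {1..N}" using 1(2) Cons uv by auto
    have "odd_letters (u @ v) = {}"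
      using 1(3) unfolding Cons uv by (auto simp: odd_letters_append split: if_splits)
    then have IH: "word (u @ v) = 1 \<or> word (u @ v) = - 1"
      using 1(1) sets(2) Cons uv by auto
    have "word w = (X i * word u * X i) * word v"
      by (simp add: Cons uv word_append mult.assoc)
    also have "\<dots> = (e i * swap_sign i (odd_letters u)) *C word (u @ v)"
      by (simp add: conj_word[OF sets(1) i(1)] scale_mult_left word_append)
    finally have w: "word w = (e i * swap_sign i (odd_letters u)) *C word (u @ v)" .
    let ?t = "e i * swap_sign i (odd_letters u)"
    have "?t * ?t = 1"
      using e_square[OF i(1)] swap_sign_square[of i "odd_letters u"] by (simp add: algebra_simps)
    then have "?t = 1 \<or> ?t = - 1" by (simp add: square_eq_1_iff)
    then show ?thesis using IH w by auto
  qed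
qed

lemma word_mult_rev:
  assumes "set w \<subseteq> {1..N}"
  shows "word w * word (rev w) = prod_list (map e w) *C 1"
  using assms
proof (induction w)
  case (Cons i w)
  have "word (i # w) * word (rev (i # w)) = X i * (word w * word (rev w)) * X i"
    by (simp add: word_append mult.assoc)
  also have "\<dots> = (prod_list (map e w) * e i) *C 1"
    using Cons X_square[of i] by (simp add: scale_mult_left scale_mult_right)
  finally show ?case by (simp add: mult.commute)
qed simp

subsection \<open>The average over conjugations\<close>

text \<open>Averaging over conjugation by \<open>x\<^sub>i\<close> projects onto the commutant of \<open>x\<^sub>i\<close>. The product of these
  projections projects onto the centre, which consists of the scalars when \<open>N\<close> is even; on a matrix
  algebra it is the normalized trace.\<close>

definition half_conj :: "nat \<Rightarrow> 'c \<Rightarrow> 'c" where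
  "half_conj i a = (1 / 2) *C (a + e i *C (X i * a * X i))"

fun averages :: "nat list \<Rightarrow> 'c \<Rightarrow> 'c" where
  "averages [] a = a"
| "averages (i # w) a = half_conj i (averages w a)"

definition scalar_part :: "'c \<Rightarrow> 'c" where
  "scalar_part = averages [1..<Suc N]"

lemma half_conj_add: "half_conj i (a + b) = half_conj i a + half_conj i b"
  and half_conj_scale: "half_conj i (t *C a) = t *C half_conj i a"
  by (simp_all add: half_conj_def algebra_simps scale_mult_left scale_mult_right)

lemma averages_add: "averages w (a + b) = averages w a + averages w b"
  and averages_scale: "averages w (t *C a) = t *C averages w a"
  by (induction w) (simp_all add: half_conj_add half_conj_scale)

lemma scalar_part_linear: "Vector_Spaces.linear scale scale scalar_part"
  by unfold_locales (simp_all add: scalar_part_def averages_add averages_scale)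

lemma averages_word:
  assumes "set w \<subseteq> {1..N}" and "set v \<subseteq> {1..N}" and two: "(2::'k) \<noteq> 0"
  shows "averages v (word w) =
    (if \<forall>i\<in>set v. swap_sign i (odd_letters w) = 1 then word w else 0)"
  using assms(2)
proof (induction v)
  case Nil
  then show ?case by simp
next
  case (Cons i v)
  have i: "i \<in> {1..N}" using Cons.prems by simp
  have half: "half_conj i (word w) = (if swap_sign i (odd_letters w) = 1 then word w else 0)"
  proof -
    let ?s = "swap_sign i (odd_letters w)"
    have s: "?s = 1 \<or> ?s = - 1" by (rule swap_sign_cases)
    have "e i * (e i * ?s) = ?s" using e_square[OF i] by (simp flip: mult.assoc)
    then have half: "half_conj i (word w) = ((1 / 2) * (1 + ?s)) *C word w"
      unfolding half_conj_def conj_word[OF assms(1) i]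
      by (simp add: scale_left_distrib scale_right_distrib distrib_left)
    show ?thesis using s two half by (cases "?s = 1") simp_all
  qed
  have zero: "half_conj i 0 = 0" by (simp add: half_conj_def)
  show ?case using Cons half zero by auto
qed

text \<open>A word with odd letters \<open>K \<noteq> {}\<close> anticommutes with some letter: with one in \<open>K\<close> if \<open>card K\<close> is
  even, and with one outside \<open>K\<close> if \<open>card K\<close> is odd. In the second case such a letter exists because
  \<open>N\<close> is even.\<close>

lemma scalar_part_word:
  assumes "set w \<subseteq> {1..N}" and "even N" and two: "(2::'k) \<noteq> 0"
  shows "scalar_part (word w) = (if odd_letters w = {} then word w else 0)"
proof -
  let ?K = "odd_letters w"
  have K: "?K \<subseteq> {1..N}" using odd_letters_subset assms(1) by blast
  have ne: "(1::'k) \<noteq> - 1" using two by (metis add.right_inverse one_add_one)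
  have "(\<forall>i\<in>{1..N}. swap_sign i ?K = 1) \<longleftrightarrow> ?K = {}"
  proof
    assume all: "\<forall>i\<in>{1..N}. swap_sign i ?K = 1"
    show "?K = {}"
    proof (cases "even (card ?K)")
      case True
      show ?thesis
      proof (rule ccontr)
        assume "?K \<noteq> {}"
        then obtain i where "i \<in> ?K" by blast
        then show False using all K True ne unfolding swap_sign_def by force
      qed
    next
      case False
      then have "?K \<noteq> {1..N}" using assms(2) by auto
      then obtain i where "i \<in> {1..N}" "i \<notin> ?K" using K by blast
      then show ?thesis using all False ne unfolding swap_sign_def by force
    qed
  qed (simp add: swap_sign_def)
  moreover have "set [1..<Suc N] = {1..N}" by auto
  ultimately show ?thesis
    unfolding scalar_part_def using averages_word[OF assms(1) _ two, of "[1..<Suc N]"] by auto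
qed

subsection \<open>Products of two letters\<close>

definition metric :: "nat \<Rightarrow> nat \<Rightarrow> 'k" where
  "metric i j = (if i = j then e i else 0)"

text \<open>The exterior product \<open>x\<^sub>i \<and> x\<^sub>j = [x\<^sub>i, x\<^sub>j] / 2\<close>. Unlike \<open>x\<^sub>i x\<^sub>j\<close> it is alternating on the
  diagonal too, which allows sums over all pairs of indices.\<close>

definition wedge :: "nat \<Rightarrow> nat \<Rightarrow> 'c" where
  "wedge i j = X i * X j - metric i j *C 1"

lemma metric_sym: "metric i j = metric j i"
  by (simp add: metric_def)

lemma X_mult_X: "X i * X j = wedge i j + metric i j *C 1"
  by (simp add: wedge_def)

lemma wedge_self: "i \<in> {1..N} \<Longrightarrow> wedge i i = 0"
  by (simp add: wedge_def metric_def X_square)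

lemma wedge_neq: "i \<noteq> j \<Longrightarrow> wedge i j = X i * X j"
  by (simp add: wedge_def metric_def)

lemma wedge_antisym: "i \<in> {1..N} \<Longrightarrow> j \<in> {1..N} \<Longrightarrow> wedge i j = - wedge j i"
  by (cases "i = j") (simp_all add: wedge_self wedge_neq X_anticomm[of i j])

end

section \<open>The monomial basis\<close>

(* Keeps the index range {1..N} in the form in which the assumptions mention it. *)
declare One_nat_def [simp del]

locale even_clifford_frame = clifford_frame +
  assumes even_N: "even N" and two_neq_0: "(2::'a) \<noteq> 0"
    and span_words: "span {word w |w. set w \<subseteq> {1..N}} = UNIV"
begin

definition monomial :: "nat set \<Rightarrow> 'b" where
  "monomial K = word (sorted_list_of_set K)"

lemma word_induct [case_names word add scale]:
  assumes "\<And>w. set w \<subseteq> {1..N} \<Longrightarrow> P (word w)"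
    and "\<And>a b. P a \<Longrightarrow> P b \<Longrightarrow> P (a + b)" and "\<And>t a. P a \<Longrightarrow> P (t *C a)"
  shows "P a"
proof -
  have "a \<in> span {word w |w. set w \<subseteq> {1..N}}" using span_words by simp
  then show ?thesis
  proof (induction rule: span_induct_alt)
    case base
    then show ?case using assms(3)[of "word []" 0] assms(1)[of "[]"] by simp
  next
    case (step t u b)
    then show ?case using assms by auto
  qed
qed

lemma odd_letters_sorted: "K \<subseteq> {1..N} \<Longrightarrow> odd_letters (sorted_list_of_set K) = K"
  by (simp add: odd_letters_distinct finite_subset)

lemma set_sorted: "K \<subseteq> {1..N} \<Longrightarrow> set (sorted_list_of_set K) = K"
  by (simp add: finite_subset)

lemma word_square:
  assumes "set w \<subseteq> {1..N}"
  shows "word w * word w = 1 \<or> word w * word w = - 1"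
  unfolding word_append[symmetric]
  by (rule word_no_odd_letters) (use assms in \<open>auto simp: odd_letters_append\<close>)

text \<open>A word times the monomial with the same odd letters has no odd letters left, hence is a sign.\<close>

lemma word_eq_monomial:
  assumes "set w \<subseteq> {1..N}"
  shows "word w = monomial (odd_letters w) \<or> word w = - monomial (odd_letters w)"
proof -
  let ?v = "sorted_list_of_set (odd_letters w)"
  have K: "odd_letters w \<subseteq> {1..N}" using odd_letters_subset assms by blast
  then have v: "set ?v \<subseteq> {1..N}" by (simp add: set_sorted)
  have "word (w @ ?v) = 1 \<or> word (w @ ?v) = - 1"
    by (rule word_no_odd_letters)
       (use assms v in \<open>auto simp: odd_letters_append odd_letters_sorted[OF K]\<close>)
  then have "word w * word ?v * word ?v = word ?v \<or> word w * word ?v * word ?v = - word ?v"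
    by (auto simp: word_append)
  moreover have "word w * word ?v * word ?v = word w \<or> word w * word ?v * word ?v = - word w"
    using word_square[OF v] by (auto simp: mult.assoc)
  ultimately show ?thesis unfolding monomial_def by (metis minus_minus)
qed

lemma span_monomials: "span (monomial ` Pow {1..N}) = UNIV"
proof -
  have "a \<in> span (monomial ` Pow {1..N})" for a
  proof (induction a rule: word_induct)
    case (word w)
    then have "odd_letters w \<in> Pow {1..N}" using odd_letters_subset by blast
    then have "monomial (odd_letters w) \<in> span (monomial ` Pow {1..N})"
      by (intro span_base imageI)
    then show ?case using word_eq_monomial[OF word] span_neg by metis
  qed (auto intro: span_add span_scale)
  then show ?thesis by blast
qed

lemma scalar_part_0 [simp]: "scalar_part 0 = 0"
  and scalar_part_add: "scalar_part (a + b) = scalar_part a + scalar_part b"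
  and scalar_part_scale: "scalar_part (t *C a) = t *C scalar_part a"
  and scalar_part_sum: "scalar_part (sum h A) = (\<Sum>x\<in>A. scalar_part (h x))"
  using scalar_part_linear
  by (simp_all add: linear_iff_module_hom module_hom.zero module_hom.add module_hom.scale
      module_hom.sum)

text \<open>The scalar part of a product of two monomials is a delta function up to sign, so it reads off
  coefficients; this makes the monomials independent.\<close>

lemma scalar_part_monomials:
  assumes "K \<subseteq> {1..N}" and "L \<subseteq> {1..N}"
  shows "K \<noteq> L \<Longrightarrow> scalar_part (monomial K * monomial L) = 0"
    and "K = L \<Longrightarrow> scalar_part (monomial K * monomial L) = 1 \<or> scalar_part (monomial K * monomial L) = - 1"
proof -
  let ?w = "sorted_list_of_set K @ sorted_list_of_set L"
  have w: "set ?w \<subseteq> {1..N}" using assms set_sorted by auto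
  have "odd_letters ?w = sym_diff K L"
    using assms by (simp add: odd_letters_append odd_letters_sorted)
  moreover have "sym_diff K L = {} \<longleftrightarrow> K = L" by blast
  moreover have "monomial K * monomial L = word ?w" by (simp add: monomial_def word_append)
  ultimately show "K \<noteq> L \<Longrightarrow> scalar_part (monomial K * monomial L) = 0"
    and "K = L \<Longrightarrow> scalar_part (monomial K * monomial L) = 1 \<or> scalar_part (monomial K * monomial L) = - 1"
    using scalar_part_word[OF w even_N two_neq_0] word_no_odd_letters[OF w] by auto
qed

lemma monomial_sum_eq_0:
  assumes "(\<Sum>K\<in>Pow {1..N}. t K *C monomial K) = 0" and "L \<subseteq> {1..N}"
  shows "t L = 0"
proof -
  let ?c = "\<lambda>K. scalar_part (monomial L * monomial K)"
  have "(\<Sum>K\<in>Pow {1..N}. t K *C ?c K) = scalar_part (monomial L * (\<Sum>K\<in>Pow {1..N}. t K *C monomial K))"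
    by (simp add: sum_distrib_left scale_mult_right scalar_part_sum scalar_part_scale)
  also have "\<dots> = 0" using assms(1) by simp
  also have "(\<Sum>K\<in>Pow {1..N}. t K *C ?c K) = (\<Sum>K\<in>{L}. t K *C ?c K)"
    by (rule sum.mono_neutral_right) (use assms(2) scalar_part_monomials(1)[OF assms(2)] in auto)
  finally show ?thesis
    using scalar_part_monomials(2)[of L L] assms(2) by auto
qed

lemma inj_on_monomial: "inj_on monomial (Pow {1..N})"
proof (rule inj_onI, rule ccontr)
  fix K L
  assume KL: "K \<in> Pow {1..N}" "L \<in> Pow {1..N}" "monomial K = monomial L" "K \<noteq> L"
  then have "scalar_part (monomial K * monomial K) = 0"
    using scalar_part_monomials(1)[of K L] by simp
  then show False using scalar_part_monomials(2)[of K K] KL by auto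
qed

lemma independent_monomials: "independent (monomial ` Pow {1..N})"
proof (rule independent_if_scalars_zero)
  fix f x
  assume "(\<Sum>x\<in>monomial ` Pow {1..N}. f x *C x) = 0" and x: "x \<in> monomial ` Pow {1..N}"
  then have "(\<Sum>K\<in>Pow {1..N}. f (monomial K) *C monomial K) = 0"
    by (simp add: sum.reindex[OF inj_on_monomial])
  then show "f x = 0" using monomial_sum_eq_0[of "\<lambda>K. f (monomial K)"] x by auto
qed simp

lemma scalar_part_nondegenerate:
  assumes "\<And>w. set w \<subseteq> {1..N} \<Longrightarrow> scalar_part (word w * a) = 0"
  shows "a = 0"
proof -
  have "a \<in> span (monomial ` Pow {1..N})" using span_monomials by simp
  then obtain f where "a = (\<Sum>x\<in>monomial ` Pow {1..N}. f x *C x)"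
    by (auto simp: span_finite)
  then have a: "a = (\<Sum>K\<in>Pow {1..N}. f (monomial K) *C monomial K)"
    by (simp add: sum.reindex[OF inj_on_monomial])
  have "f (monomial L) = 0" if L: "L \<in> Pow {1..N}" for L
  proof -
    let ?c = "\<lambda>K. scalar_part (monomial L * monomial K)"
    have "0 = scalar_part (monomial L * a)"
      using assms[of "sorted_list_of_set L"] L by (simp add: monomial_def set_sorted)
    also have "\<dots> = (\<Sum>K\<in>Pow {1..N}. f (monomial K) *C ?c K)"
      by (simp add: a sum_distrib_left scale_mult_right scalar_part_sum scalar_part_scale)
    also have "\<dots> = (\<Sum>K\<in>{L}. f (monomial K) *C ?c K)"
      by (rule sum.mono_neutral_right) (use L scalar_part_monomials(1)[of L] in auto)
    finally show ?thesis
      using scalar_part_monomials(2)[of L L] L by auto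
  qed
  then show ?thesis by (simp add: a)
qed

section \<open>The sum of conjugates and the volume element\<close>

definition conj_sum :: "'b \<Rightarrow> 'b" where
  "conj_sum a = (\<Sum>i\<in>{1..N}. e i *C (X i * a * X i))"

lemma conj_sum_add: "conj_sum (a + b) = conj_sum a + conj_sum b"
  and conj_sum_scale: "conj_sum (t *C a) = t *C conj_sum a"
  by (simp_all add: conj_sum_def distrib_left distrib_right scale_right_distrib sum.distrib
      scale_mult_left scale_mult_right scale_sum_right mult.commute)

text \<open>Conjugation by one of the \<open>k\<close> odd letters of the word and by one of the \<open>N - k\<close> other letters give
  opposite signs.\<close>

lemma conj_sum_word:
  assumes "set w \<subseteq> {1..N}"
  defines "k \<equiv> card (odd_letters w)"
  shows "conj_sum (word w) = ((- 1) ^ k * (of_nat N - 2 * of_nat k)) *C word w"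
proof -
  let ?K = "odd_letters w"
  have K: "?K \<subseteq> {1..N}" using odd_letters_subset assms by blast
  have "conj_sum (word w) = (\<Sum>i\<in>{1..N}. swap_sign i ?K) *C word w"
    unfolding conj_sum_def scale_sum_left
    by (rule sum.cong[OF refl])
       (simp add: conj_word[OF assms(1)] e_square flip: mult.assoc)
  moreover have "(\<Sum>i\<in>{1..N}. swap_sign i ?K) = (- 1) ^ k * (of_nat N - 2 * of_nat k)"
  proof -
    have "(\<Sum>i\<in>{1..N}. swap_sign i ?K) =
        (- 1) ^ k * (\<Sum>i\<in>{1..N}. if i \<in> ?K then - 1 else 1)"
      by (simp add: swap_sign_def k_def sum_distrib_left)
    also have "(\<Sum>i\<in>{1..N}. if i \<in> ?K then - 1 else (1::'a)) =
        (\<Sum>i\<in>{1..N}. 1) - 2 * (\<Sum>i\<in>{1..N}. if i \<in> ?K then 1 else 0)"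
      by (subst sum_distrib_left, subst sum_subtractf[symmetric], rule sum.cong) auto
    also have "(\<Sum>i\<in>{1..N}. if i \<in> ?K then 1 else (0::'a)) = of_nat k"
      using K by (simp add: k_def sum.inter_restrict[symmetric] Int_absorb1)
    finally show ?thesis by simp
  qed
  ultimately show ?thesis by simp
qed

definition volume :: 'b where
  "volume = word [1..<Suc N]"

text \<open>Reversing the volume element produces the sign in front of the product.\<close>

definition volume_sq :: 'a where
  "volume_sq = (- 1) ^ (N choose 2) * (\<Prod>i\<in>{1..N}. e i)"

lemma set_upt_N: "set [1..<Suc N] = {1..N}"
  by auto

lemma odd_letters_volume: "odd_letters [1..<Suc N] = {1..N}"
  using odd_letters_distinct[of "[1..<Suc N]"] set_upt_N by simp

lemma volume_eq_monomial: "volume = monomial {1..N}"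
  by (simp add: volume_def monomial_def atLeastLessThanSuc_atLeastAtMost[symmetric]
      del: upt_Suc)

lemma volume_rev: "word (rev [1..<Suc N]) = (- 1) ^ (N choose 2) *C volume"
  using word_rev[of "[1..<Suc N]"] set_upt_N odd_letters_volume
  by (simp add: volume_def del: upt_Suc)

lemma volume_square: "volume * volume = volume_sq *C 1"
proof -
  have "prod_list (map e [1..<Suc N]) = (\<Prod>i\<in>{1..N}. e i)"
    by (simp add: prod.distinct_set_conv_list[symmetric] atLeastLessThanSuc_atLeastAtMost
        del: upt_Suc)
  then have "(- 1) ^ (N choose 2) *C (volume * volume) = (\<Prod>i\<in>{1..N}. e i) *C 1"
    using word_mult_rev[of "[1..<Suc N]"] volume_rev set_upt_N
    by (simp add: scale_mult_right volume_def del: upt_Suc)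
  then have "(- 1) ^ (N choose 2) *C (- 1) ^ (N choose 2) *C (volume * volume) = volume_sq *C 1"
    by (simp add: volume_sq_def)
  then show ?thesis by (simp flip: power_add)
qed

lemma volume_sq_square: "volume_sq * volume_sq = 1"
proof -
  have "(\<Prod>i\<in>{1..N}. e i) * (\<Prod>i\<in>{1..N}. e i) = 1"
    unfolding prod.distrib[symmetric] by (rule prod.neutral) (use e_square in auto)
  moreover have "(- 1) ^ (N choose 2) * (- 1) ^ (N choose 2) = (1::'a)"
    by (simp flip: power_add)
  ultimately show ?thesis unfolding volume_sq_def by (metis mult.assoc mult.commute mult_1)
qed

lemma volume_sq_neq_0: "volume_sq \<noteq> 0"
  using volume_sq_square by auto

lemma X_volume: "i \<in> {1..N} \<Longrightarrow> X i * volume = - (volume * X i)"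
  using X_word[of "[1..<Suc N]" i, unfolded set_upt_N] even_N
  by (simp add: volume_def odd_letters_volume swap_sign_def del: upt_Suc)

lemma word_volume:
  assumes "set w \<subseteq> {1..N}"
  shows "volume * word w = (- 1) ^ length w *C (word w * volume)"
  using assms
proof (induction w)
  case (Cons i w)
  have "volume * word (i # w) = - (X i * (volume * word w))"
    using X_volume[of i] Cons.prems by (simp flip: mult.assoc)
  then show ?case using Cons by (simp add: scale_mult_right mult.assoc)
qed simp

lemma volume_commutes:
  assumes "i \<in> {1..N}" and "j \<in> {1..N}"
  shows "volume * (X i * X j) = X i * X j * volume"
  using word_volume[of "[i, j]"] assms by simp

lemma volume_conj_word:
  assumes "set w \<subseteq> {1..N}"
  shows "volume * word w * volume = ((- 1) ^ card (odd_letters w) * volume_sq) *C word w"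
  unfolding word_volume[OF assms] minus_one_card
  by (simp add: scale_mult_left mult.assoc volume_square scale_mult_right)

end

section \<open>Spinor representations and the symmetry of the spinor norm\<close>

locale spinor_rep = even_clifford_frame scale N X e + S: vector_space scaleS
  for scale :: "'k::field \<Rightarrow> 'c::ring_1 \<Rightarrow> 'c" (infixr "*C" 75) and N X e
    and scaleS :: "'k \<Rightarrow> 's::ab_group_add \<Rightarrow> 's" (infixr "*S" 75) +
  fixes act :: "'c \<Rightarrow> 's \<Rightarrow> 's" (infixr "\<star>" 75) and B :: "'s \<Rightarrow> 's \<Rightarrow> 'k"
  assumes act_bij: "bij_betw act UNIV {f. Vector_Spaces.linear scaleS scaleS f}"
    and act_add_left: "(c + d) \<star> \<psi> = c \<star> \<psi> + d \<star> \<psi>"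
    and act_scale_left: "(t *C c) \<star> \<psi> = t *S (c \<star> \<psi>)"
    and act_mult: "(c * d) \<star> \<psi> = c \<star> (d \<star> \<psi>)"
    and act_one [simp]: "1 \<star> \<psi> = \<psi>"
    and B_add_left: "B (\<phi> + \<phi>') \<psi> = B \<phi> \<psi> + B \<phi>' \<psi>"
    and B_add_right: "B \<phi> (\<psi> + \<psi>') = B \<phi> \<psi> + B \<phi> \<psi>'"
    and B_scale_left: "B (t *S \<phi>) \<psi> = t * B \<phi> \<psi>"
    and B_scale_right: "B \<phi> (t *S \<psi>) = t * B \<phi> \<psi>"
    and B_X: "i \<in> {1..N} \<Longrightarrow> B (X i \<star> \<phi>) \<psi> = B \<phi> (X i \<star> \<psi>)"
    and B_nondegenerate_left: "(\<And>\<psi>. B \<phi> \<psi> = 0) \<Longrightarrow> \<phi> = 0"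
    and B_nondegenerate_right: "(\<And>\<phi>. B \<phi> \<psi> = 0) \<Longrightarrow> \<psi> = 0"
begin

lemma act_linear: "Vector_Spaces.linear scaleS scaleS (act c)"
  using act_bij by (auto simp: bij_betw_def)

lemma act_add_right: "c \<star> (\<phi> + \<psi>) = c \<star> \<phi> + c \<star> \<psi>"
  and act_scale_right: "c \<star> (t *S \<psi>) = t *S (c \<star> \<psi>)"
  and act_zero_right [simp]: "c \<star> 0 = 0"
  and act_diff_right: "c \<star> (\<phi> - \<psi>) = c \<star> \<phi> - c \<star> \<psi>"
  using act_linear[of c]
  by (simp_all add: linear_iff_module_hom module_hom.zero module_hom.add module_hom.scale
      module_hom.diff)

lemma act_zero_left [simp]: "0 \<star> \<psi> = 0"
  using act_scale_left[of 0 0 \<psi>] by simp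

lemma act_minus_left: "(- c) \<star> \<psi> = - (c \<star> \<psi>)"
  using act_scale_left[of "- 1" c \<psi>] by simp

lemma act_diff_left: "(c - d) \<star> \<psi> = c \<star> \<psi> - d \<star> \<psi>"
  using act_add_left[of c "- d" \<psi>] by (simp add: act_minus_left)

lemma act_sum_left: "(sum h A) \<star> \<psi> = (\<Sum>x\<in>A. h x \<star> \<psi>)"
  by (induction A rule: infinite_finite_induct) (simp_all add: act_add_left)

lemma B_zero_left [simp]: "B 0 \<psi> = 0"
  and B_zero_right [simp]: "B \<psi> 0 = 0"
  and B_minus_left: "B (- \<phi>) \<psi> = - B \<phi> \<psi>"
  and B_minus_right: "B \<psi> (- \<phi>) = - B \<psi> \<phi>"
  using B_scale_left[of 0 0 \<psi>] B_scale_right[of \<psi> 0 0] B_scale_left[of "- 1" \<phi> \<psi>]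
    B_scale_right[of \<psi> "- 1" \<phi>] by simp_all

lemma B_diff_right: "B \<psi> (\<phi> - \<phi>') = B \<psi> \<phi> - B \<psi> \<phi>'"
  using B_add_right[of \<psi> \<phi> "- \<phi>'"] by (simp add: B_minus_right)

lemma B_sum_right: "B \<psi> (sum h A) = (\<Sum>x\<in>A. B \<psi> (h x))"
  by (induction A rule: infinite_finite_induct) (simp_all add: B_add_right)

lemma B_linear: "Vector_Spaces.linear scaleS (*) (B \<psi>)"
  by unfold_locales (simp_all add: algebra_simps B_add_right B_scale_right)

lemma act_faithful:
  assumes "\<And>\<psi>. c \<star> \<psi> = 0"
  shows "c = 0"
  using act_bij assms unfolding bij_betw_def inj_on_def
  by (metis UNIV_I act_zero_left ext)

lemma rank_one:
  assumes "Vector_Spaces.linear scaleS (*) h"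
  obtains a where "\<And>\<psi>. a \<star> \<psi> = h \<psi> *S \<phi>"
proof -
  interpret h: module_hom scaleS "(*)" h using assms by (simp add: linear_iff_module_hom)
  have "Vector_Spaces.linear scaleS scaleS (\<lambda>\<psi>. h \<psi> *S \<phi>)"
    by unfold_locales (simp_all add: h.add h.scale S.scale_left_distrib)
  then have "(\<lambda>\<psi>. h \<psi> *S \<phi>) \<in> range act"
    using act_bij by (auto simp: bij_betw_def)
  then show ?thesis using that by (metis rangeE)
qed

lemma B_word:
  assumes "set w \<subseteq> {1..N}"
  shows "B (word w \<star> \<phi>) \<psi> = B \<phi> (word (rev w) \<star> \<psi>)"
  using assms by (induction w arbitrary: \<phi> \<psi>) (simp_all add: act_mult word_append B_X)

text \<open>The adjoint of a word is the reversed word, and words span.\<close>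

lemma adjoint_exists:
  "\<exists>c'. (\<forall>\<phi> \<psi>. B (c \<star> \<phi>) \<psi> = B \<phi> (c' \<star> \<psi>)) \<and> (\<forall>\<phi> \<psi>. B (c' \<star> \<phi>) \<psi> = B \<phi> (c \<star> \<psi>))"
proof (induction c rule: word_induct)
  case (word w)
  then show ?case using B_word[of w] B_word[of "rev w"] by (intro exI[of _ "word (rev w)"]) simp
next
  case (add c d)
  then obtain c' d' where
    "\<forall>\<phi> \<psi>. B (c \<star> \<phi>) \<psi> = B \<phi> (c' \<star> \<psi>)" "\<forall>\<phi> \<psi>. B (c' \<star> \<phi>) \<psi> = B \<phi> (c \<star> \<psi>)"
    "\<forall>\<phi> \<psi>. B (d \<star> \<phi>) \<psi> = B \<phi> (d' \<star> \<psi>)" "\<forall>\<phi> \<psi>. B (d' \<star> \<phi>) \<psi> = B \<phi> (d \<star> \<psi>)"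
    by blast
  then show ?case by (intro exI[of _ "c' + d'"]) (simp add: act_add_left B_add_left B_add_right)
next
  case (scale t c)
  then obtain c' where
    "\<forall>\<phi> \<psi>. B (c \<star> \<phi>) \<psi> = B \<phi> (c' \<star> \<psi>)" "\<forall>\<phi> \<psi>. B (c' \<star> \<phi>) \<psi> = B \<phi> (c \<star> \<psi>)"
    by blast
  then show ?case
    by (intro exI[of _ "t *C c'"]) (simp add: act_scale_left B_scale_left B_scale_right)
qed

lemma B_eqI:
  assumes "\<And>\<alpha>. B \<alpha> \<phi> = B \<alpha> \<psi>"
  shows "\<phi> = \<psi>"
  using B_nondegenerate_right[of "\<phi> - \<psi>"] assms by (simp add: B_diff_right)

text \<open>Every element of the algebra has an adjoint for \<open>B\<close>, and the adjoint of the rank-one element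
  \<open>B(\<theta>, -) \<phi>\<close> is \<open>B(\<phi>, -) \<theta>'\<close>, where \<open>\<theta>'\<close> is the transpose of \<open>\<theta>\<close>. Taking the adjoint on the
  other side must give the same element, and this forces \<open>\<theta>'\<close> to be a fixed multiple of \<open>\<theta>\<close>.\<close>

lemma B_transpose_proportional: "\<exists>t. \<forall>\<phi> \<psi>. B \<phi> \<psi> = t * B \<psi> \<phi>"
proof (cases "\<exists>\<theta>::'s. \<theta> \<noteq> 0")
  case True
  then obtain \<theta> \<eta> where \<theta>: "B \<theta> \<eta> \<noteq> 0" using B_nondegenerate_left by metis
  have adj: "\<exists>R'. (\<forall>\<alpha> \<psi>. B \<alpha> (R' \<star> \<psi>) = B \<theta> \<alpha> * B \<phi> \<psi>) \<and>
      (\<forall>\<alpha> \<psi>. B (R' \<star> \<alpha>) \<psi> = B \<theta> \<psi> * B \<alpha> \<phi>)" for \<phi>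
  proof -
    obtain R where R: "\<And>\<psi>. R \<star> \<psi> = B \<theta> \<psi> *S \<phi>" using rank_one[OF B_linear] by blast
    obtain R' where "\<forall>\<alpha> \<psi>. B (R \<star> \<alpha>) \<psi> = B \<alpha> (R' \<star> \<psi>)"
      and "\<forall>\<alpha> \<psi>. B (R' \<star> \<alpha>) \<psi> = B \<alpha> (R \<star> \<psi>)"
      using adjoint_exists[of R] by blast
    then show ?thesis by (intro exI[of _ R']) (simp add: R B_scale_left B_scale_right)
  qed
  obtain R' where R': "\<And>\<alpha> \<psi>. B \<alpha> (R' \<star> \<psi>) = B \<theta> \<alpha> * B \<theta> \<psi>" using adj[of \<theta>] by blast
  define \<theta>' where "\<theta>' = (1 / B \<theta> \<eta>) *S (R' \<star> \<eta>)"
  have \<theta>': "B \<alpha> \<theta>' = B \<theta> \<alpha>" for \<alpha>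
    using \<theta> by (simp add: \<theta>'_def B_scale_right R')
  have "B \<alpha> \<phi> = (B \<theta>' \<eta> / B \<theta> \<eta>) * B \<phi> \<alpha>" for \<alpha> \<phi>
  proof -
    obtain Q where Q: "\<And>\<alpha> \<psi>. B \<alpha> (Q \<star> \<psi>) = B \<theta> \<alpha> * B \<phi> \<psi>"
      "\<And>\<alpha> \<psi>. B (Q \<star> \<alpha>) \<psi> = B \<theta> \<psi> * B \<alpha> \<phi>"
      using adj[of \<phi>] by blast
    have "Q \<star> \<alpha> = B \<phi> \<alpha> *S \<theta>'"
      by (rule B_eqI) (simp add: Q B_scale_right \<theta>' mult.commute)
    then have "B \<theta> \<eta> * B \<alpha> \<phi> = B \<phi> \<alpha> * B \<theta>' \<eta>"
      using Q(2)[of \<alpha> \<eta>] by (simp add: B_scale_left)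
    then show ?thesis using \<theta> by (simp add: field_simps)
  qed
  then show ?thesis by blast
next
  case False
  then have "B \<phi> \<psi> = 1 * B \<psi> \<phi>" for \<phi> \<psi> by (metis mult_1)
  then show ?thesis by blast
qed

end

text \<open>With \<open>f\<close> and \<open>g\<close> as in the lemma, \<open>f g\<close> and \<open>g f\<close> are complementary idempotents on \<open>U\<close>, and
  \<open>g\<close> carries the image of the first isomorphically onto that of the second.\<close>

lemma (in finite_dimensional_vector_space) dim_eq_twice_dim_image:
  assumes U: "subspace U" and f: "Vector_Spaces.linear scale scale f"
    and g: "Vector_Spaces.linear scale scale g"
    and fU: "\<And>u. u \<in> U \<Longrightarrow> f u \<in> U" and gU: "\<And>u. u \<in> U \<Longrightarrow> g u \<in> U"
    and ff: "\<And>u. u \<in> U \<Longrightarrow> f (f u) = 0" and gf: "\<And>u. u \<in> U \<Longrightarrow> g (f u) + f (g u) = u"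
  shows "dim U = 2 * dim (f ` U)"
proof -
  interpret f: Vector_Spaces.linear scale scale f by (rule f)
  interpret g: Vector_Spaces.linear scale scale g by (rule g)
  interpret P: finite_dimensional_vector_space_pair_1 scale Basis scale by unfold_locales
  have sf: "subspace (f ` U)" by (rule f.subspace_image[OF U])
  have sg: "subspace (g ` f ` U)" by (rule g.subspace_image[OF sf])
  have fgf: "f (g (f u)) = f u" if "u \<in> U" for u
    using gf[OF fU[OF that]] ff[OF that] by (simp add: g.zero)
  have "U = {x + y |x y. x \<in> f ` U \<and> y \<in> g ` f ` U}"
  proof (intro equalityI subsetI)
    fix u assume u: "u \<in> U"
    have "u = f (g u) + g (f u)" using gf[OF u] by (simp add: add.commute)
    then show "u \<in> {x + y |x y. x \<in> f ` U \<and> y \<in> g ` f ` U}" using u gU by blast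
  next
    fix u assume "u \<in> {x + y |x y. x \<in> f ` U \<and> y \<in> g ` f ` U}"
    then show "u \<in> U" using fU gU subspace_add[OF U] by auto
  qed
  moreover have "f ` U \<inter> g ` f ` U = {0}"
  proof
    show "f ` U \<inter> g ` f ` U \<subseteq> {0}"
    proof
      fix x assume "x \<in> f ` U \<inter> g ` f ` U"
      then obtain u v where uv: "u \<in> U" "v \<in> U" "x = f u" "x = g (f v)" by blast
      then have "f v = f x" using fgf[OF uv(2)] by metis
      also have "f x = 0" using ff uv by simp
      finally show "x \<in> {0}" using uv by (simp add: g.zero)
    qed
    show "{0} \<subseteq> f ` U \<inter> g ` f ` U" using sf sg subspace_0 by auto
  qed
  moreover have "dim (g ` f ` U) = dim (f ` U)"
  proof (rule P.dim_image_eq[OF g])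
    have "inj_on g (f ` U)" by (rule inj_on_inverseI[where g = f]) (use fgf in auto)
    then show "inj_on g (span (f ` U))" using sf by (simp add: span_eq_iff[THEN iffD2])
  qed
  ultimately show ?thesis using dim_sums_Int[OF sf sg] by simp
qed

lemma (in vector_space) finite_dimensional_if_dim_neq_0:
  assumes "dim UNIV \<noteq> 0"
  obtains Basis where "finite_dimensional_vector_space scale Basis" and "card Basis = dim UNIV"
proof -
  obtain A where A: "independent A" "UNIV \<subseteq> span A" "card A = dim UNIV"
    using basis_exists[of UNIV] by blast
  then have "finite A" using assms card_ge_0_finite by fastforce
  then have "finite_dimensional_vector_space scale A" using A by unfold_locales auto
  then show ?thesis using that A by blast
qed

context spinor_rep
begin

text \<open>The product of a maximal family of anticommuting square-zero elements is an operator of rank one,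
  because each factor halves the dimension. It is selfadjoint up to the sign \<open>(- 1)\<^bsup>n choose 2\<^esup>\<close>,
  and on its image this sign decides whether \<open>B\<close> is symmetric.\<close>

lemma B_symmetry:
  fixes f g :: "nat \<Rightarrow> 'c"
  assumes dim: "S.dim UNIV = 2 ^ n"
    and ff: "\<And>i j. i < n \<Longrightarrow> j < n \<Longrightarrow> f i * f j = - (f j * f i)"
    and f_square: "\<And>i. i < n \<Longrightarrow> f i * f i = 0"
    and gf: "\<And>i j. i < n \<Longrightarrow> j < n \<Longrightarrow> g i * f j + f j * g i = (if i = j then 1 else 0)"
    and B_f: "\<And>i \<phi> \<psi>. i < n \<Longrightarrow> B (f i \<star> \<phi>) \<psi> = B \<phi> (f i \<star> \<psi>)"
  shows "B \<phi> \<psi> = (- 1) ^ (n choose 2) * B \<psi> \<phi>"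
proof -
  obtain Basis where "finite_dimensional_vector_space scaleS Basis"
    using S.finite_dimensional_if_dim_neq_0 dim by auto
  then interpret S: finite_dimensional_vector_space scaleS Basis .
  define P where "P = rec_nat 1 (\<lambda>k p. f k * p)"
  have P0: "P 0 = 1" and PS: "P (Suc k) = f k * P k" for k by (simp_all add: P_def)
  have fP: "f i * P k = (- 1) ^ k * (P k * f i)" if "i < n" "k \<le> n" for i k
    using that(2)
  proof (induction k)
    case (Suc k)
    have "f i * P (Suc k) = - (f k * (f i * P k))"
      using ff[of i k] that Suc.prems by (simp add: PS flip: mult.assoc)
    then show ?case using Suc by (simp add: PS mult.assoc minus_one_power_iff)
  qed (simp add: P0)
  have gP: "g i * P k = (- 1) ^ k * (P k * g i)" if "i < n" "k \<le> i" for i k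
    using that(2)
  proof (induction k)
    case (Suc k)
    have "g i * f k = - (f k * g i)"
      using gf[of i k] that Suc.prems by (simp add: add_eq_0_iff2)
    then have "g i * P (Suc k) = - (f k * (g i * P k))"
      by (simp add: PS flip: mult.assoc)
    then show ?case using Suc by (simp add: PS mult.assoc minus_one_power_iff)
  qed (simp add: P0)
  have sign: "((- 1) ^ k * c) \<star> \<psi> = (- 1) ^ k *S (c \<star> \<psi>)" for k c \<psi>
    by (simp add: minus_one_power_iff act_minus_left)
  define U where "U k = range (act (P k))" for k
  have subU: "S.subspace (U k)" for k
    unfolding U_def using act_linear[of "P k"]
    by (simp add: linear_iff_module_hom module_hom.subspace_image)
  have stable: "c \<star> u \<in> U k" if c: "c * P k = (- 1) ^ k * (P k * c)" and u: "u \<in> U k" for c u k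
  proof -
    obtain \<psi> where "u = P k \<star> \<psi>" using u by (auto simp: U_def)
    then have "c \<star> u = (- 1) ^ k *S (P k \<star> (c \<star> \<psi>))"
      using c by (simp add: sign flip: act_mult)
    then show ?thesis using S.subspace_scale[OF subU] by (simp add: U_def)
  qed
  have "S.dim (U k) * 2 ^ k = 2 ^ n" if "k \<le> n" for k
    using that
  proof (induction k)
    case 0
    have "U 0 = UNIV" by (auto simp: U_def P0)
    then show ?case using dim by simp
  next
    case (Suc k)
    have k: "k < n" using Suc.prems by simp
    have "S.dim (U k) = 2 * S.dim (act (f k) ` U k)"
    proof (rule S.dim_eq_twice_dim_image[OF subU act_linear act_linear[of "g k"]])
      show "f k \<star> u \<in> U k" if "u \<in> U k" for u
        using stable[OF fP that] k by simp
      show "g k \<star> u \<in> U k" if "u \<in> U k" for u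
        using stable[OF gP that] k by simp
      show "f k \<star> (f k \<star> u) = 0" for u using f_square[OF k] by (simp flip: act_mult)
      show "g k \<star> (f k \<star> u) + f k \<star> (g k \<star> u) = u" for u
        using gf[OF k k] by (simp flip: act_mult act_add_left)
    qed
    moreover have "act (f k) ` U k = U (Suc k)"
      by (auto simp: U_def PS act_mult)
    ultimately show ?case using Suc by simp
  qed
  from this[of n] have "S.dim (U n) = 1" by simp
  then obtain A where A: "U n \<subseteq> S.span A" "card A = 1" "A \<subseteq> U n" "S.independent A"
    using S.basis_exists[of "U n"] by metis
  obtain \<phi>\<^sub>0 where \<phi>\<^sub>0: "A = {\<phi>\<^sub>0}" using A(2) by (rule card_1_singletonE)
  have "\<exists>t. P n \<star> \<psi> = t *S \<phi>\<^sub>0" for \<psi>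
    using A(1) unfolding \<phi>\<^sub>0 S.span_singleton U_def by blast
  then have "\<exists>h. \<forall>\<psi>. P n \<star> \<psi> = h \<psi> *S \<phi>\<^sub>0" by (intro choice) blast
  then obtain h where h: "\<And>\<psi>. P n \<star> \<psi> = h \<psi> *S \<phi>\<^sub>0" by blast
  have "\<phi>\<^sub>0 \<noteq> 0" using A(4) \<phi>\<^sub>0 by simp
  moreover obtain \<phi>\<^sub>1 where "\<phi>\<^sub>0 = P n \<star> \<phi>\<^sub>1" using A(3) \<phi>\<^sub>0 by (auto simp: U_def)
  ultimately have h1: "h \<phi>\<^sub>1 \<noteq> 0" using h[of \<phi>\<^sub>1] by (metis S.scale_zero_left)
  have adj: "B (P k \<star> \<phi>) \<psi> = (- 1) ^ (k choose 2) * B \<phi> (P k \<star> \<psi>)" if "k \<le> n" for k \<phi> \<psi>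
    using that
  proof (induction k arbitrary: \<phi> \<psi>)
    case 0
    then show ?case by (simp add: P0 numeral_2_eq_2)
  next
    case (Suc k)
    have "B (P (Suc k) \<star> \<phi>) \<psi> = (- 1) ^ (k choose 2) * B \<phi> ((P k * f k) \<star> \<psi>)"
      using Suc B_f[of k] by (simp add: PS act_mult)
    also have "(P k * f k) \<star> \<psi> = (- 1) ^ k *S (P (Suc k) \<star> \<psi>)"
      using fP[of k k] Suc.prems by (simp add: PS sign flip: power_add)
    finally show ?case
      by (simp add: B_scale_right numeral_2_eq_2 power_add mult.assoc mult.left_commute)
  qed
  obtain t where t: "\<And>\<phi> \<psi>. B \<phi> \<psi> = t * B \<psi> \<phi>" using B_transpose_proportional by blast
  let ?s = "(- 1 :: 'k) ^ (n choose 2)"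
  have hB: "h \<phi> * B \<phi>\<^sub>0 \<psi> = ?s * h \<psi> * B \<phi> \<phi>\<^sub>0" for \<phi> \<psi>
    using adj[of n \<phi> \<psi>] by (simp add: h B_scale_left B_scale_right mult.assoc)
  have "B \<phi>\<^sub>0 \<phi>\<^sub>1 = ?s * B \<phi>\<^sub>1 \<phi>\<^sub>0" using hB[of \<phi>\<^sub>1 \<phi>\<^sub>1] h1 by simp
  moreover have "B \<phi>\<^sub>1 \<phi>\<^sub>0 \<noteq> 0"
  proof
    assume "B \<phi>\<^sub>1 \<phi>\<^sub>0 = 0"
    then have "B \<phi>\<^sub>0 \<psi> = 0" for \<psi> using hB[of \<phi>\<^sub>1 \<psi>] h1 by simp
    then show False using B_nondegenerate_left \<open>\<phi>\<^sub>0 \<noteq> 0\<close> by blast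
  qed
  ultimately have "t = ?s" using t[of \<phi>\<^sub>0 \<phi>\<^sub>1] by simp
  then show ?thesis using t[of \<phi> \<psi>] by simp
qed

end

section \<open>The bracket of two spinors\<close>

locale spinor_rep_10 = spinor_rep +
  assumes N_eq_10: "N = 10" and three_neq_0: "(3::'a) \<noteq> 0"
    and B_sym: "B \<phi> \<psi> = B \<psi> \<phi>"
begin

text \<open>Summing over all pairs, with the same product in both factors, makes the
  invariance of \<open>L\<close> and its recoupling visible. The scalar \<open>5 B(\<phi>, \<psi>)\<close> in \<open>L\<close> removes the diagonal
  terms. The usual form of \<open>L\<close> is the one in \<open>L_eq_increasing\<close>.\<close>

definition pair_sum :: "'c \<Rightarrow> 'c \<Rightarrow> 'b" where
  "pair_sum \<phi> \<psi> =
     (\<Sum>i\<in>{1..N}. \<Sum>j\<in>{1..N}. (e i * e j * B \<phi> ((X j * X i) \<star> \<psi>)) *C (X j * X i))"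

definition L :: "'c \<Rightarrow> 'c \<Rightarrow> 'b" where
  "L \<phi> \<psi> = (- (1 / 2)) *C pair_sum \<phi> \<psi> + (5 * B \<phi> \<psi>) *C 1
     + (3 * volume_sq * B \<phi> (volume \<star> \<psi>)) *C volume"

lemma L_add_left: "L (\<phi> + \<phi>') \<psi> = L \<phi> \<psi> + L \<phi>' \<psi>"
  and L_add_right: "L \<phi> (\<psi> + \<psi>') = L \<phi> \<psi> + L \<phi> \<psi>'"
  and L_scale_left: "L (t *S \<phi>) \<psi> = t *C L \<phi> \<psi>"
  and L_scale_right: "L \<phi> (t *S \<psi>) = t *C L \<phi> \<psi>"
  by (simp_all add: L_def pair_sum_def B_add_left B_add_right B_scale_left B_scale_right
      act_add_right act_scale_right scale_left_distrib scale_right_distrib distrib_left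
      sum.distrib scale_sum_right mult.left_commute mult.assoc algebra_simps)

lemma sign_10: "(- 1 :: 'a) ^ (N choose 2) = - 1"
  by (simp add: N_eq_10 choose_two)

lemma B_volume: "B (volume \<star> \<phi>) \<psi> = - B \<phi> (volume \<star> \<psi>)"
  using B_word[of "[1..<Suc N]" \<phi> \<psi>, unfolded set_upt_N volume_rev sign_10]
  by (simp add: volume_def act_minus_left B_minus_right del: upt_Suc)

lemma volume_volume: "volume \<star> volume \<star> \<psi> = volume_sq *S \<psi>"
  by (simp add: volume_square act_scale_left flip: act_mult)

lemma B_XX:
  assumes "i \<in> {1..N}" and "j \<in> {1..N}"
  shows "B ((X i * X j) \<star> \<phi>) \<psi> = B \<phi> ((X j * X i) \<star> \<psi>)"
  using B_word[of "[i, j]" \<phi> \<psi>] assms by simp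

lemma L_volume: "L (volume \<star> \<phi>) (volume \<star> \<psi>) = (- volume_sq) *C L \<phi> \<psi>"
proof -
  have "B (volume \<star> \<phi>) ((X j * X i) \<star> volume \<star> \<psi>) = - volume_sq * B \<phi> ((X j * X i) \<star> \<psi>)"
    if "i \<in> {1..N}" "j \<in> {1..N}" for i j
  proof -
    have "volume \<star> (X j * X i) \<star> volume \<star> \<psi> = (X j * X i) \<star> volume \<star> volume \<star> \<psi>"
      using volume_commutes[OF that(2,1)] by (metis act_mult)
    then show ?thesis by (simp add: B_volume volume_volume act_scale_right B_scale_right)
  qed
  then have "pair_sum (volume \<star> \<phi>) (volume \<star> \<psi>) = (- volume_sq) *C pair_sum \<phi> \<psi>"
    unfolding pair_sum_def scale_sum_right
    by (intro sum.cong refl) (simp add: mult.left_commute)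
  then show ?thesis
    by (simp add: L_def B_volume volume_volume act_scale_right B_scale_right scale_right_distrib
        algebra_simps)
qed

lemma pair_sum_wedge:
  "pair_sum \<phi> \<psi> = (\<Sum>i\<in>{1..N}. \<Sum>j\<in>{1..N}. (e i * e j * B \<phi> ((X j * X i) \<star> \<psi>)) *C wedge j i)
     + (10 * B \<phi> \<psi>) *C 1"
proof -
  let ?q = "\<lambda>i j. e i * e j * B \<phi> ((X j * X i) \<star> \<psi>)"
  have diag: "?q i i * e i = B \<phi> \<psi>" if "i \<in> {1..N}" for i
  proof -
    have "e i * (e i * (e i * (e i * t))) = t" for t
      using e_square[OF that] by (simp flip: mult.assoc)
    then show ?thesis
      using X_square[OF that] by (simp add: act_scale_left B_scale_right ac_simps)
  qed
  have "pair_sum \<phi> \<psi> = (\<Sum>i\<in>{1..N}. \<Sum>j\<in>{1..N}. ?q i j *C wedge j i)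
      + (\<Sum>i\<in>{1..N}. \<Sum>j\<in>{1..N}. (?q i j * metric j i) *C 1)"
    unfolding pair_sum_def sum.distrib[symmetric]
    by (intro sum.cong refl) (simp add: X_mult_X scale_right_distrib)
  also have "(\<Sum>i\<in>{1..N}. \<Sum>j\<in>{1..N}. (?q i j * metric j i) *C 1) = (\<Sum>i\<in>{1..N}. B \<phi> \<psi> *C 1)"
  proof (rule sum.cong[OF refl])
    fix i assume i: "i \<in> {1..N}"
    have "(\<Sum>j\<in>{1..N}. (?q i j * metric j i) *C 1) = (\<Sum>j\<in>{1..N}. if j = i then (?q i i * e i) *C 1 else 0)"
      by (rule sum.cong) (auto simp: metric_def)
    then show "(\<Sum>j\<in>{1..N}. (?q i j * metric j i) *C 1) = B \<phi> \<psi> *C 1"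
      using i diag[OF i] by simp
  qed
  also have "\<dots> = (10 * B \<phi> \<psi>) *C 1"
    unfolding scale_sum_left[symmetric] by (simp add: N_eq_10)
  finally show ?thesis .
qed

lemma L_wedge:
  "L \<phi> \<psi> = (- (1 / 2)) *C (\<Sum>i\<in>{1..N}. \<Sum>j\<in>{1..N}. (e i * e j * B \<phi> ((X j * X i) \<star> \<psi>)) *C wedge j i)
     + (3 * volume_sq * B \<phi> (volume \<star> \<psi>)) *C volume"
proof -
  have "10 * B \<phi> \<psi> = 2 * (5 * B \<phi> \<psi>)" by simp
  moreover have "2 * (5 * B \<phi> \<psi>) / 2 = 5 * B \<phi> \<psi>"
    by (rule nonzero_mult_div_cancel_left[OF two_neq_0])
  ultimately have "- (1 / 2) * (10 * B \<phi> \<psi>) = - (5 * B \<phi> \<psi>)"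
    by (simp only: mult_minus_left times_divide_eq_left mult_1)
  then have ten: "(- (1 / 2)) *C ((10 * B \<phi> \<psi>) *C 1) = (- (5 * B \<phi> \<psi>)) *C 1"
    by (simp only: scale_scale)
  show ?thesis
    unfolding L_def pair_sum_wedge scale_right_distrib ten scale_minus_left[of "5 * B \<phi> \<psi>"]
    by (simp only: add.assoc minus_add_cancel)
qed

lemma L_antisym: "L \<phi> \<psi> = - L \<psi> \<phi>"
proof -
  have BX: "B \<phi> ((X j * X i) \<star> \<psi>) = B \<psi> ((X i * X j) \<star> \<phi>)"
    if "i \<in> {1..N}" "j \<in> {1..N}" for i j
    using B_XX[OF that, of \<phi> \<psi>] by (simp add: B_sym[of \<psi>])
  let ?Q = "\<lambda>\<phi> \<psi>. \<Sum>i\<in>{1..N}. \<Sum>j\<in>{1..N}. (e i * e j * B \<phi> ((X j * X i) \<star> \<psi>)) *C wedge j i"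
  have "?Q \<phi> \<psi> = (\<Sum>i\<in>{1..N}. \<Sum>j\<in>{1..N}. - ((e j * e i * B \<psi> ((X i * X j) \<star> \<phi>)) *C wedge i j))"
  proof (intro sum.cong refl)
    fix i j assume ij: "i \<in> {1..N}" "j \<in> {1..N}"
    show "(e i * e j * B \<phi> ((X j * X i) \<star> \<psi>)) *C wedge j i = - ((e j * e i * B \<psi> ((X i * X j) \<star> \<phi>)) *C wedge i j)"
      unfolding BX[OF ij] wedge_antisym[OF ij(2,1)] by (simp add: mult.commute)
  qed
  also have "\<dots> = - ?Q \<psi> \<phi>" unfolding sum_negf by (subst sum.swap) (rule refl)
  finally have Q: "?Q \<phi> \<psi> = - ?Q \<psi> \<phi>" .
  have "B \<phi> (volume \<star> \<psi>) = - B \<psi> (volume \<star> \<phi>)"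
    using B_volume[of \<phi> \<psi>] by (simp add: B_sym[of \<psi>])
  then show ?thesis unfolding L_wedge Q by simp
qed

lemma L_self [simp]: "L \<phi> \<phi> = 0"
proof -
  have "(2::'a) *C L \<phi> \<phi> = L \<phi> \<phi> + L \<phi> \<phi>"
    using scale_left_distrib[of 1 1 "L \<phi> \<phi>"] by simp
  also have "\<dots> = 0" by (metis L_antisym add.right_inverse)
  finally show ?thesis using two_neq_0 by simp
qed

section \<open>Recoupling and the cyclic identity\<close>

definition recouple :: "'b \<Rightarrow> 'b" where
  "recouple a = (- (1 / 2)) *C conj_sum (conj_sum a) + 5 *C a - (3 * volume_sq) *C (volume * a * volume)"

lemma recouple_add: "recouple (a + b) = recouple a + recouple b"
  and recouple_scale: "recouple (t *C a) = t *C recouple a"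
  by (simp_all add: recouple_def conj_sum_add conj_sum_scale scale_right_distrib
      scale_right_diff_distrib distrib_left distrib_right scale_mult_left scale_mult_right
      mult.commute mult.left_commute)

text \<open>In every summand of \<open>h(L(\<psi>, \<chi>)\<theta>)\<close> the factor with \<open>B\<close> is moved to the form \<open>B(\<chi>, u \<psi>)\<close>; the scalar
  \<open>h(v \<theta>)\<close> next to it then turns \<open>u \<psi>\<close> into \<open>u a v \<theta>\<close>. So the spinor \<open>\<psi>\<close> and the functional \<open>h\<close> enter
  only through \<open>a\<close>.\<close>

lemma L_recouple:
  assumes h: "Vector_Spaces.linear scaleS (*) h" and a: "\<And>\<theta>. a \<star> \<theta> = h \<theta> *S \<psi>"
  shows "h (L \<psi> \<chi> \<star> \<theta>) = B \<chi> (recouple a \<star> \<theta>)"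
proof -
  interpret h: module_hom scaleS "(*)" h using h by (simp add: linear_iff_module_hom)
  have BX: "B \<psi> ((X j * X i) \<star> \<chi>) = B \<chi> ((X i * X j) \<star> \<psi>)"
    if "i \<in> {1..N}" "j \<in> {1..N}" for i j
    using B_XX[OF that, of \<psi> \<chi>] by (simp add: B_sym[of \<chi>])
  have "h (pair_sum \<psi> \<chi> \<star> \<theta>) =
      (\<Sum>i\<in>{1..N}. \<Sum>j\<in>{1..N}. e i * e j * B \<chi> ((X i * X j) \<star> \<psi>) * h ((X j * X i) \<star> \<theta>))"
    unfolding pair_sum_def act_sum_left h.sum
    by (intro sum.cong refl) (simp add: act_scale_left h.scale BX)
  also have "\<dots> = (\<Sum>i\<in>{1..N}. \<Sum>j\<in>{1..N}.
      B \<chi> ((e i *C (X i * (e j *C (X j * a * X j)) * X i)) \<star> \<theta>))"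
    by (intro sum.cong refl)
       (simp only: scale_mult_left scale_mult_right scale_scale act_scale_left act_mult a
         act_scale_right S.scale_scale B_scale_right ac_simps)
  also have "\<dots> = B \<chi> (conj_sum (conj_sum a) \<star> \<theta>)"
    unfolding conj_sum_def
    by (simp only: sum_distrib_left sum_distrib_right scale_sum_right act_sum_left B_sum_right)
  finally have 1: "h (pair_sum \<psi> \<chi> \<star> \<theta>) = B \<chi> (conj_sum (conj_sum a) \<star> \<theta>)" .
  have 2: "B \<psi> (volume \<star> \<chi>) * h (volume \<star> \<theta>) = - B \<chi> ((volume * a * volume) \<star> \<theta>)"
    using B_volume[of \<chi> \<psi>]
    by (simp add: act_mult a act_scale_right B_scale_right B_sym[of \<psi>] mult.commute)
  have 3: "B \<psi> \<chi> * h \<theta> = B \<chi> (a \<star> \<theta>)" by (simp add: a B_scale_right B_sym[of \<psi>] mult.commute)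
  have "h (L \<psi> \<chi> \<star> \<theta>) = - (1 / 2) * h (pair_sum \<psi> \<chi> \<star> \<theta>) + 5 * (B \<psi> \<chi> * h \<theta>)
      + 3 * volume_sq * (B \<psi> (volume \<star> \<chi>) * h (volume \<star> \<theta>))"
    by (simp only: L_def act_add_left act_scale_left h.add h.scale act_one mult.assoc)
  also have "\<dots> = B \<chi> (recouple a \<star> \<theta>)"
    unfolding 1 2 3 recouple_def act_add_left act_diff_left act_scale_left B_add_right
      B_diff_right B_scale_right by simp
  finally show ?thesis .
qed

definition recouple_value :: "nat \<Rightarrow> 'a" where
  "recouple_value k = 5 - 2 * (5 - of_nat k)\<^sup>2 - 3 * (- 1) ^ k"

lemma recouple_word:
  assumes "set w \<subseteq> {1..N}"
  shows "recouple (word w) = recouple_value (card (odd_letters w)) *C word w"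
proof -
  let ?k = "card (odd_letters w)"
  have sq: "(- 1) ^ ?k * ((- 1) ^ ?k * t) = t" for t :: 'a
    by (simp flip: mult.assoc power_add)
  have ten: "of_nat N = (10 :: 'a)" by (simp add: N_eq_10)
  have "conj_sum (conj_sum (word w)) = (2 * 2 * (5 - of_nat ?k)\<^sup>2) *C word w"
  proof -
    have "conj_sum (conj_sum (word w)) =
        ((- 1) ^ ?k * (10 - 2 * of_nat ?k) * ((- 1) ^ ?k * (10 - 2 * of_nat ?k))) *C word w"
      by (simp add: conj_sum_word[OF assms] conj_sum_scale ten)
    moreover have "(- 1) ^ ?k * (10 - 2 * of_nat ?k) * ((- 1) ^ ?k * (10 - 2 * of_nat ?k))
        = (10 - 2 * of_nat ?k) * (10 - 2 * (of_nat ?k :: 'a))"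
      using sq[of "(10 - 2 * of_nat ?k) * (10 - 2 * of_nat ?k)"] by (simp only: ac_simps)
    moreover have "(10 - 2 * of_nat ?k) * (10 - 2 * (of_nat ?k :: 'a)) = 2 * 2 * (5 - of_nat ?k)\<^sup>2"
      by (simp add: power2_eq_square algebra_simps)
    ultimately show ?thesis by simp
  qed
  moreover have "- (1 / 2) * (2 * 2 * (5 - of_nat ?k)\<^sup>2) = - (2 * (5 - (of_nat ?k :: 'a))\<^sup>2)"
    using two_neq_0 by (simp add: field_simps)
  moreover have "3 * volume_sq * ((- 1) ^ ?k * volume_sq) = 3 * (- 1) ^ ?k"
    using volume_sq_square by (simp add: ac_simps)
  ultimately have "recouple (word w) =
      (- (2 * (5 - of_nat ?k)\<^sup>2)) *C word w + 5 *C word w - (3 * (- 1) ^ ?k) *C word w"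
    by (simp only: recouple_def volume_conj_word[OF assms] scale_scale)
  then show ?thesis
    by (simp add: recouple_value_def algebra_simps)
qed

text \<open>The second factor vanishes for \<open>k\<close> congruent to \<open>0\<close> or \<open>1\<close> modulo \<open>4\<close> and the third for even \<open>k\<close>. What
  remains is \<open>k = 3\<close> and \<open>k = 7\<close>, where the eigenvalue is \<open>5 - 8 + 3\<close>.\<close>

lemma recouple_cancellation:
  assumes "k \<le> 10"
  shows "recouple_value k * (1 - (- 1) ^ (k choose 2)) * (1 - (- 1) ^ k) = 0"
proof -
  have "k \<in> {0, 1, 2, 3, 4, 5, 6, 7, 8, 9, 10}"
    unfolding insert_iff empty_iff using assms by presburger
  then show ?thesis by (auto simp: recouple_value_def choose_two power2_eq_square)
qed

text \<open>On a word, exchanging \<open>\<psi>\<close> and \<open>\<chi>\<close> produces the sign of its reversal and the terms with the volume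
  element, which restrict to equal chirality, produce \<open>- (- 1)\<^sup>k\<close>. The factors in
  \<open>recouple_cancellation\<close> are the resulting ones.\<close>

lemma recouple_antisym:
  "B \<psi> (recouple b \<star> \<chi>) - B \<chi> (recouple b \<star> \<psi>)
     + volume_sq * (B (volume \<star> \<psi>) (recouple b \<star> volume \<star> \<chi>) - B (volume \<star> \<chi>) (recouple b \<star> volume \<star> \<psi>)) = 0"
proof (induction b rule: word_induct)
  case (word w)
  let ?k = "card (odd_letters w)" and ?y = "recouple_value (card (odd_letters w))"
  have "?k \<le> card {1..N}"
    using odd_letters_subset[of w] word by (intro card_mono) auto
  then have k: "?k \<le> 10" by (simp add: N_eq_10)
  have 1: "B \<chi> (word w \<star> \<psi>) = (- 1) ^ (?k choose 2) * B \<psi> (word w \<star> \<chi>)" for \<chi> \<psi>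
    using B_word[OF word, of \<psi> \<chi>] word_rev[OF word]
    by (simp add: B_sym[of \<chi>] act_scale_left B_scale_right)
  have 2: "volume_sq * B (volume \<star> \<psi>) (word w \<star> volume \<star> \<chi>) = - ((- 1) ^ ?k * B \<psi> (word w \<star> \<chi>))" for \<chi> \<psi>
  proof -
    have "volume \<star> word w \<star> volume \<star> \<chi> = ((- 1) ^ ?k * volume_sq) *S (word w \<star> \<chi>)"
      using volume_conj_word[OF word] by (metis act_mult act_scale_left mult.assoc)
    then show ?thesis
      using volume_sq_square by (simp add: B_volume B_scale_right ac_simps)
  qed
  have "B \<psi> (recouple (word w) \<star> \<chi>) - B \<chi> (recouple (word w) \<star> \<psi>)
      + volume_sq * (B (volume \<star> \<psi>) (recouple (word w) \<star> volume \<star> \<chi>)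
        - B (volume \<star> \<chi>) (recouple (word w) \<star> volume \<star> \<psi>))
    = ?y * (B \<psi> (word w \<star> \<chi>) - B \<chi> (word w \<star> \<psi>)
        + (volume_sq * B (volume \<star> \<psi>) (word w \<star> volume \<star> \<chi>)
          - volume_sq * B (volume \<star> \<chi>) (word w \<star> volume \<star> \<psi>)))"
    unfolding recouple_word[OF word] by (simp add: act_scale_left B_scale_right algebra_simps)
  also have "\<dots> = ?y * (1 - (- 1) ^ (?k choose 2)) * (1 - (- 1) ^ ?k) * B \<psi> (word w \<star> \<chi>)"
    unfolding 2 unfolding 1[of \<chi> \<psi>] by (simp add: algebra_simps)
  finally show ?case unfolding recouple_cancellation[OF k] by simp
next
  case (add a b)
  then show ?case
    by (simp add: recouple_add act_add_left B_add_right algebra_simps)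
next
  case (scale t a)
  have "B \<psi> (recouple (t *C a) \<star> \<chi>) - B \<chi> (recouple (t *C a) \<star> \<psi>)
      + volume_sq * (B (volume \<star> \<psi>) (recouple (t *C a) \<star> volume \<star> \<chi>)
        - B (volume \<star> \<chi>) (recouple (t *C a) \<star> volume \<star> \<psi>))
    = t * (B \<psi> (recouple a \<star> \<chi>) - B \<chi> (recouple a \<star> \<psi>)
      + volume_sq * (B (volume \<star> \<psi>) (recouple a \<star> volume \<star> \<chi>)
        - B (volume \<star> \<chi>) (recouple a \<star> volume \<star> \<psi>)))"
    by (simp add: recouple_scale act_scale_left B_scale_right algebra_simps)
  then show ?case using scale by simp
qed

definition jacobiator :: "'c \<Rightarrow> 'c \<Rightarrow> 'c \<Rightarrow> 'c" where
  "jacobiator \<phi> \<psi> \<chi> = L \<phi> \<psi> \<star> \<chi> + L \<psi> \<chi> \<star> \<phi> + L \<chi> \<phi> \<star> \<psi>"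

text \<open>If \<open>\<psi>\<close> and \<open>\<chi>\<close> have the same chirality, then \<open>L(\<psi>, \<chi>) = 0\<close>, and the other two terms cancel by
  \<open>recouple_antisym\<close>. The statement is this fact without a choice of a square root of \<open>volume_sq\<close>:
  the part of the jacobiator that is invariant under twisting both \<open>\<psi>\<close> and \<open>\<chi>\<close> vanishes.\<close>

lemma jacobiator_volume: "jacobiator \<phi> (volume \<star> \<psi>) (volume \<star> \<chi>) = (- volume_sq) *S jacobiator \<phi> \<psi> \<chi>"
proof -
  have "B \<theta> (jacobiator \<phi> \<psi> \<chi>) + volume_sq * B \<theta> (jacobiator \<phi> (volume \<star> \<psi>) (volume \<star> \<chi>)) = 0" for \<theta>
  proof -
    obtain a where a: "\<And>\<xi>. a \<star> \<xi> = B \<theta> \<xi> *S \<phi>" using rank_one[OF B_linear] by blast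
    have K: "B \<theta> (L \<phi> \<psi> \<star> \<chi>) = B \<psi> (recouple a \<star> \<chi>)" for \<psi> \<chi>
      by (rule L_recouple[OF B_linear a])
    have K': "B \<theta> (L \<chi> \<phi> \<star> \<psi>) = - B \<chi> (recouple a \<star> \<psi>)" for \<psi> \<chi>
      using K[of \<chi> \<psi>] L_antisym[of \<chi> \<phi>] by (simp add: act_minus_left B_minus_right)
    have M: "volume_sq * B \<theta> (L (volume \<star> \<psi>) (volume \<star> \<chi>) \<star> \<phi>) = - B \<theta> (L \<psi> \<chi> \<star> \<phi>)"
      using volume_sq_square
      by (simp add: L_volume act_minus_left act_scale_left B_minus_right B_scale_right
          flip: mult.assoc)
    have "B \<theta> (jacobiator \<phi> \<psi> \<chi>) + volume_sq * B \<theta> (jacobiator \<phi> (volume \<star> \<psi>) (volume \<star> \<chi>)) =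
        B \<psi> (recouple a \<star> \<chi>) - B \<chi> (recouple a \<star> \<psi>) + volume_sq *
          (B (volume \<star> \<psi>) (recouple a \<star> volume \<star> \<chi>) - B (volume \<star> \<chi>) (recouple a \<star> volume \<star> \<psi>))"
      unfolding jacobiator_def B_add_right K K' distrib_left M by (simp add: algebra_simps)
    then show ?thesis unfolding recouple_antisym .
  qed
  then have "B \<theta> (volume_sq *S jacobiator \<phi> (volume \<star> \<psi>) (volume \<star> \<chi>)) = B \<theta> (- jacobiator \<phi> \<psi> \<chi>)" for \<theta>
    by (simp add: B_scale_right B_minus_right eq_neg_iff_add_eq_0 add.commute)
  then have "volume_sq *S jacobiator \<phi> (volume \<star> \<psi>) (volume \<star> \<chi>) = - jacobiator \<phi> \<psi> \<chi>"
    by (rule B_eqI)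
  then have "volume_sq *S volume_sq *S jacobiator \<phi> (volume \<star> \<psi>) (volume \<star> \<chi>) = volume_sq *S - jacobiator \<phi> \<psi> \<chi>"
    by simp
  then show ?thesis by (simp add: volume_sq_square)
qed

lemma jacobiator_rotate: "jacobiator \<phi> \<psi> \<chi> = jacobiator \<psi> \<chi> \<phi>"
  by (simp add: jacobiator_def algebra_simps)

lemma jacobiator_scale: "jacobiator \<phi> \<psi> (t *S \<chi>) = t *S jacobiator \<phi> \<psi> \<chi>"
  by (simp add: jacobiator_def L_scale_left L_scale_right act_scale_left act_scale_right
      S.scale_right_distrib)

text \<open>Since the jacobiator is cyclic, twisting any two of its arguments by the volume element multiplies it
  by \<open>- volume_sq\<close>. Twisting the pairs \<open>(\<psi>, \<chi>)\<close> and \<open>(\<phi>, \<chi>)\<close> in succession twists \<open>\<chi>\<close> twice, which is a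
  scalar, and amounts to twisting \<open>(\<phi>, \<psi>)\<close>; comparing the three signs gives the jacobiator equal to its
  negative.\<close>

lemma jacobiator_zero: "jacobiator \<phi> \<psi> \<chi> = 0"
proof -
  let ?v = "\<lambda>\<psi>. volume \<star> \<psi>"
  have "jacobiator (?v \<phi>) (?v \<psi>) (?v (?v \<chi>)) = (- volume_sq) *S jacobiator (?v \<phi>) \<psi> (?v \<chi>)"
    by (rule jacobiator_volume)
  also have "jacobiator (?v \<phi>) \<psi> (?v \<chi>) = (- volume_sq) *S jacobiator \<phi> \<psi> \<chi>"
    using jacobiator_volume[of \<psi> \<chi> \<phi>] by (metis jacobiator_rotate)
  finally have "jacobiator (?v \<phi>) (?v \<psi>) (?v (?v \<chi>)) = jacobiator \<phi> \<psi> \<chi>"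
    by (simp add: volume_sq_square)
  moreover have "jacobiator (?v \<phi>) (?v \<psi>) (?v (?v \<chi>)) = - jacobiator \<phi> \<psi> \<chi>"
  proof -
    have "jacobiator (?v \<phi>) (?v \<psi>) \<chi> = (- volume_sq) *S jacobiator \<phi> \<psi> \<chi>"
      using jacobiator_volume[of \<chi> \<phi> \<psi>] by (metis jacobiator_rotate)
    then show ?thesis by (simp add: volume_volume jacobiator_scale volume_sq_square)
  qed
  ultimately have "2 *S jacobiator \<phi> \<psi> \<chi> = 0"
    by (metis S.scale_left_distrib S.scale_one add.right_inverse one_add_one)
  then show ?thesis using two_neq_0 by simp
qed

end

section \<open>The Lie algebra acting on spinors\<close>

context clifford_frame
begin

lemma commutator_X:
  assumes "a \<in> {1..N}" "b \<in> {1..N}" "i \<in> {1..N}" "a \<noteq> b"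
  shows "X a * X b * X i - X i * (X a * X b) = (2 * metric b i) *C X a - (2 * metric a i) *C X b"
proof -
  have two: "(2 * t) *C u = t *C u + t *C u" for t u by (metis mult_2 scale_left_distrib)
  have anti: "X i * X j = - (X j * X i)" if "i \<in> {1..N}" "j \<in> {1..N}" "i \<noteq> j" for i j
    using X_anticomm that by blast
  have anti': "X i * (X j * u) = - (X j * (X i * u))" if "i \<in> {1..N}" "j \<in> {1..N}" "i \<noteq> j" for i j u
    unfolding mult.assoc[symmetric] anti[OF that] by simp
  have sq: "X i * X i = e i *C 1" "X i * (X i * u) = e i *C u" if "i \<in> {1..N}" for i u
    unfolding mult.assoc[symmetric] X_square[OF that] by (simp_all add: scale_mult_left)
  consider "i = a" | "i = b" | "i \<noteq> a" "i \<noteq> b" by blast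
  then show ?thesis
  proof cases
    case 1
    have "X a * X b * X a = - (e a *C X b)"
      unfolding mult.assoc anti'[OF assms(1,2,4)] sq[OF assms(1)] by (simp add: scale_mult_right)
    then show ?thesis
      unfolding 1 sq(2)[OF assms(1)] using assms(4) by (simp add: metric_def two)
  next
    case 2
    have "X b * (X a * X b) = - (e b *C X a)"
      unfolding anti'[OF assms(2,1) assms(4)[symmetric]] sq[OF assms(2)] by (simp add: scale_mult_right)
    moreover have "X a * X b * X b = e b *C X a"
      unfolding mult.assoc sq[OF assms(2)] by (simp add: scale_mult_right)
    ultimately show ?thesis
      unfolding 2 using assms(4) by (simp add: metric_def two)
  next
    case 3
    have "X i * (X a * X b) = X a * X b * X i"
      unfolding anti'[OF assms(3,1) 3(1)] anti[OF assms(3,2) 3(2)] by (simp add: mult.assoc)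
    then show ?thesis using 3 by (simp add: metric_def)
  qed
qed

text \<open>The tensor \<open>\<Sum> e\<^sub>i x\<^sub>i \<otimes> x\<^sub>i\<close> is invariant under the infinitesimal rotation \<open>[x\<^sub>a x\<^sub>b, -]\<close>.
  The bilinear map \<open>F\<close> stands for evaluation of a tensor.\<close>

lemma metric_tensor_invariant:
  fixes F :: "'c \<Rightarrow> 'c \<Rightarrow> 'c"
  assumes ab: "a \<in> {1..N}" "b \<in> {1..N}" "a \<noteq> b"
    and F: "\<And>u u' v. F (u - u') v = F u v - F u' v" "\<And>u v v'. F u (v - v') = F u v - F u v'"
      "\<And>t u v. F (t *C u) v = t *C F u v" "\<And>t u v. F u (t *C v) = t *C F u v"
  defines "D \<equiv> \<lambda>u. X a * X b * u - u * (X a * X b)"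
  shows "(\<Sum>i\<in>{1..N}. e i *C (F (D (X i)) (X i) + F (X i) (D (X i)))) = 0"
proof -
  have D: "D (X i) = (2 * metric b i) *C X a - (2 * metric a i) *C X b" if "i \<in> {1..N}" for i
    unfolding D_def using commutator_X[of a b i] ab that by simp
  let ?G = "\<lambda>u. F u (X a) + F (X a) u" and ?H = "\<lambda>u. F u (X b) + F (X b) u"
  have "(\<Sum>i\<in>{1..N}. e i *C (F (D (X i)) (X i) + F (X i) (D (X i)))) =
     (\<Sum>i\<in>{1..N}. (if i = b then (2::'k) *C ?G (X b) else 0) - (if i = a then (2::'k) *C ?H (X a) else 0))"
  proof (rule sum.cong[OF refl])
    fix i assume i: "i \<in> {1..N}"
    have ee: "e i * (2 * e i) = 2" using e_square[OF i] by (simp add: mult.left_commute)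
    have "e i *C (F (D (X i)) (X i) + F (X i) (D (X i))) =
        (e i * (2 * metric b i)) *C ?G (X i) - (e i * (2 * metric a i)) *C ?H (X i)"
      unfolding D[OF i] F by (simp add: scale_right_distrib scale_right_diff_distrib)
    also have "\<dots> = (if i = b then (2::'k) *C ?G (X b) else 0) - (if i = a then (2::'k) *C ?H (X a) else 0)"
      using ee by (auto simp: metric_def)
    finally show "e i *C (F (D (X i)) (X i) + F (X i) (D (X i))) =
      (if i = b then (2::'k) *C ?G (X b) else 0) - (if i = a then (2::'k) *C ?H (X a) else 0)" .
  qed
  also have "\<dots> = (2::'k) *C ?G (X b) - (2::'k) *C ?H (X a)"
    using ab by (simp add: sum_subtractf)
  also have "\<dots> = 0" by (simp add: add.commute)
  finally show ?thesis .
qed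

end

context even_clifford_frame
begin

definition lie_gens :: "'b set" where
  "lie_gens = {X i * X j |i j. i \<in> {1..N} \<and> j \<in> {1..N} \<and> i \<noteq> j} \<union> {volume}"

lemma lie_gens_cases:
  assumes "u \<in> lie_gens"
  obtains (pair) i j where "i \<in> {1..N}" "j \<in> {1..N}" "i \<noteq> j" "u = X i * X j"
  | (volume) "u = volume"
  using assms unfolding lie_gens_def by blast

lemma wedge_in_lie:
  assumes "i \<in> {1..N}" and "j \<in> {1..N}"
  shows "wedge i j \<in> span lie_gens"
proof (cases "i = j")
  case True
  then have "wedge i j = 0" using wedge_self[OF assms(1)] by simp
  then show ?thesis by (simp add: span_zero)
next
  case False
  then have "wedge i j \<in> lie_gens" using assms unfolding lie_gens_def by (auto simp: wedge_neq)
  then show ?thesis by (rule span_base)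
qed

text \<open>The commutator expands into four products of two letters, whose scalar parts cancel.\<close>

lemma commutator_pairs:
  assumes "a \<in> {1..N}" "b \<in> {1..N}" "a \<noteq> b" "c \<in> {1..N}" "d \<in> {1..N}"
  shows "X a * X b * (X c * X d) - X c * X d * (X a * X b) \<in> span lie_gens"
proof -
  let ?D = "\<lambda>i. X a * X b * X i - X i * (X a * X b)"
  have "X a * X b * (X c * X d) - X c * X d * (X a * X b) = ?D c * X d + X c * ?D d"
    by (simp add: algebra_simps)
  also have "\<dots> = (2 * metric b c) *C (X a * X d) - (2 * metric a c) *C (X b * X d)
      + (2 * metric b d) *C (X c * X a) - (2 * metric a d) *C (X c * X b)"
    using commutator_X[of a b c] commutator_X[of a b d] assms
    by (simp add: left_diff_distrib right_diff_distrib scale_mult_left scale_mult_right)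
  also have "\<dots> = (2 * metric b c) *C wedge a d - (2 * metric a c) *C wedge b d
      + (2 * metric b d) *C wedge c a - (2 * metric a d) *C wedge c b"
  proof -
    have m: "2 * metric b d * metric c a = 2 * metric a c * metric b d"
      "2 * metric a d * metric c b = 2 * metric b c * metric a d"
      by (simp_all add: metric_sym[of c a] metric_sym[of c b])
    show ?thesis unfolding X_mult_X scale_right_distrib scale_scale m by simp
  qed
  also have "\<dots> \<in> span lie_gens"
    using assms by (intro span_add span_diff span_scale wedge_in_lie)
  finally show ?thesis .
qed

lemma commutator_lie:
  assumes "u \<in> span lie_gens" and "v \<in> span lie_gens"
  shows "u * v - v * u \<in> span lie_gens"
proof -
  have gens: "u * v - v * u \<in> span lie_gens" if u: "u \<in> lie_gens" and v: "v \<in> lie_gens" for u v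
    using u
  proof (cases rule: lie_gens_cases)
    case (pair i j)
    note u = pair
    show ?thesis using v
    proof (cases rule: lie_gens_cases)
      case (pair k l)
      then show ?thesis using commutator_pairs u by simp
    next
      case volume
      then show ?thesis using volume_commutes u by (simp add: span_zero)
    qed
  next
    case volume
    note u = volume
    show ?thesis using v
    proof (cases rule: lie_gens_cases)
      case (pair k l)
      then show ?thesis using volume_commutes u by (simp add: span_zero)
    next
      case volume
      then show ?thesis using u by (simp add: span_zero)
    qed
  qed
  have left: "u * v - v * u \<in> span lie_gens" if "u \<in> span lie_gens" "v \<in> lie_gens" for u v
    using that(1)
  proof (induction rule: span_induct_alt)
    case (step t x y)
    have "(t *C x + y) * v - v * (t *C x + y) = t *C (x * v - v * x) + (y * v - v * y)"
      by (simp add: distrib_left distrib_right scale_mult_left scale_mult_right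
          scale_right_diff_distrib)
    then show ?case using step gens[OF _ that(2)] by (auto intro: span_add span_scale)
  qed (simp add: span_zero)
  show ?thesis using assms(2)
  proof (induction rule: span_induct_alt)
    case (step t x y)
    have "u * (t *C x + y) - (t *C x + y) * u = t *C (u * x - x * u) + (u * y - y * u)"
      by (simp add: distrib_left distrib_right scale_mult_left scale_mult_right
          scale_right_diff_distrib)
    then show ?case using step left[OF assms(1)] by (auto intro: span_add span_scale)
  qed (simp add: span_zero)
qed

end

context spinor_rep_10
begin

lemma L_in_lie: "L \<phi> \<psi> \<in> span lie_gens"
proof -
  have "volume \<in> span lie_gens" by (rule span_base) (simp add: lie_gens_def)
  then show ?thesis
    unfolding L_wedge by (intro span_add span_scale span_sum wedge_in_lie) auto
qed

text \<open>\<open>L\<close> is equivariant because it is built from \<open>B\<close>, for which pairs and the volume element are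
  skew, and from two copies of the invariant metric tensor.\<close>

lemma L_equivariant_pair:
  assumes ab: "a \<in> {1..N}" "b \<in> {1..N}" "a \<noteq> b"
  defines "A \<equiv> X a * X b"
  shows "A * L \<phi> \<psi> - L \<phi> \<psi> * A = L (A \<star> \<phi>) \<psi> + L \<phi> (A \<star> \<psi>)"
proof -
  define D where "D = (\<lambda>u. A * u - u * A)"
  have D_mult: "D (u * v) = D u * v + u * D v" for u v
    by (simp add: D_def algebra_simps)
  have D_add: "D (u + v) = D u + D v" for u v
    by (simp add: D_def algebra_simps)
  have D_sum: "D (sum h K) = (\<Sum>x\<in>K. D (h x))" for h and K :: "nat set"
    by (simp add: D_def sum_distrib_left sum_distrib_right sum_subtractf)
  have D_scale: "D (t *C u) = t *C D u" for t u
    by (simp add: D_def scale_mult_left scale_mult_right scale_right_diff_distrib)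
  have BA: "B (A \<star> \<phi>) \<psi> = - B \<phi> (A \<star> \<psi>)" for \<phi> \<psi>
    using B_XX[of a b] X_anticomm[of a b] ab by (simp add: A_def act_minus_left B_minus_right)
  define H where "H = (\<lambda>u v. B \<phi> (u \<star> \<psi>) *C v)"
  have H_left: "B (A \<star> \<phi>) (u \<star> \<psi>) + B \<phi> (u \<star> A \<star> \<psi>) = - B \<phi> (D u \<star> \<psi>)" for u
    by (simp add: BA D_def act_diff_left act_mult B_diff_right)
  have D_volume: "D volume = 0"
    using volume_commutes[of a b] ab by (simp add: D_def A_def)
  have D_one: "D 1 = 0" by (simp add: D_def)
  have inv: "(\<Sum>i\<in>{1..N}. e i *C (F (D (X i)) (X i) + F (X i) (D (X i)))) = 0"
    if "\<And>u u' v. F (u - u') v = F u v - F u' v" "\<And>u v v'. F u (v - v') = F u v - F u v'"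
      "\<And>t u v. F (t *C u) v = t *C F u v" "\<And>t u v. F u (t *C v) = t *C F u v" for F
    unfolding D_def A_def by (rule metric_tensor_invariant[OF ab that])
  have H: "H (u - u') v = H u v - H u' v" "H u (v - v') = H u v - H u v'"
    "H (u + u') v = H u v + H u' v" "H u (v + v') = H u v + H u v'"
    "H (t *C u) v = t *C H u v" "H u (t *C v) = t *C H u v" for t u u' v v'
    by (simp_all add: H_def act_diff_left act_add_left act_scale_left B_diff_right B_add_right
        B_scale_right scale_left_diff_distrib scale_right_diff_distrib scale_left_distrib
        scale_right_distrib mult.commute)
  have 1: "(\<Sum>i\<in>{1..N}. e i *C (H (X j * D (X i)) (X j * X i) + H (X j * X i) (X j * D (X i)))) = 0" for j
    by (rule inv[of "\<lambda>u v. H (X j * u) (X j * v)"])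
       (simp_all add: right_diff_distrib scale_mult_right H)
  have 2: "(\<Sum>j\<in>{1..N}. e j *C (H (D (X j) * X i) (X j * X i) + H (X j * X i) (D (X j) * X i))) = 0" for i
    by (rule inv[of "\<lambda>u v. H (u * X i) (v * X i)"])
       (simp_all add: left_diff_distrib scale_mult_left H)
  have "(\<Sum>i\<in>{1..N}. \<Sum>j\<in>{1..N}. (e i * e j) *C (H (D (X j * X i)) (X j * X i) + H (X j * X i) (D (X j * X i)))) =
      (\<Sum>j\<in>{1..N}. e j *C (\<Sum>i\<in>{1..N}. e i *C (H (X j * D (X i)) (X j * X i) + H (X j * X i) (X j * D (X i)))))
    + (\<Sum>i\<in>{1..N}. e i *C (\<Sum>j\<in>{1..N}. e j *C (H (D (X j) * X i) (X j * X i) + H (X j * X i) (D (X j) * X i))))"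
    unfolding scale_sum_right scale_scale
    by (subst (2) sum.swap, unfold sum.distrib[symmetric], intro sum.cong refl)
       (simp add: D_mult H scale_right_distrib ac_simps)
  also have "\<dots> = 0" unfolding 1 2 by simp
  finally have pair: "(\<Sum>i\<in>{1..N}. \<Sum>j\<in>{1..N}.
      (e i * e j) *C (H (D (X j * X i)) (X j * X i) + H (X j * X i) (D (X j * X i)))) = 0" .
  have "D (pair_sum \<phi> \<psi>) - (pair_sum (A \<star> \<phi>) \<psi> + pair_sum \<phi> (A \<star> \<psi>)) = (\<Sum>i\<in>{1..N}. \<Sum>j\<in>{1..N}.
      (e i * e j) *C (H (D (X j * X i)) (X j * X i) + H (X j * X i) (D (X j * X i))))"
    unfolding pair_sum_def D_sum D_scale sum.distrib[symmetric] sum_subtractf[symmetric]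
  proof (intro sum.cong refl)
    fix i j
    let ?u = "X j * X i"
    have "(e i * e j * B (A \<star> \<phi>) (?u \<star> \<psi>)) *C ?u + (e i * e j * B \<phi> (?u \<star> A \<star> \<psi>)) *C ?u
        = (e i * e j * (B (A \<star> \<phi>) (?u \<star> \<psi>) + B \<phi> (?u \<star> A \<star> \<psi>))) *C ?u"
      by (simp only: distrib_left scale_left_distrib)
    also have "\<dots> = - ((e i * e j) *C H (D ?u) ?u)"
      unfolding H_left by (simp add: H_def)
    finally show "(e i * e j * B \<phi> (?u \<star> \<psi>)) *C D ?u
        - ((e i * e j * B (A \<star> \<phi>) (?u \<star> \<psi>)) *C ?u + (e i * e j * B \<phi> (?u \<star> A \<star> \<psi>)) *C ?u)
        = (e i * e j) *C (H (D ?u) ?u + H ?u (D ?u))"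
      by (simp add: H_def scale_right_distrib)
  qed
  then have P: "D (pair_sum \<phi> \<psi>) = pair_sum (A \<star> \<phi>) \<psi> + pair_sum \<phi> (A \<star> \<psi>)"
    unfolding pair by simp
  have V: "volume \<star> A \<star> \<psi> = A \<star> volume \<star> \<psi>"
    using volume_commutes[of a b] ab unfolding A_def by (metis act_mult)
  have "D (L \<phi> \<psi>) = L (A \<star> \<phi>) \<psi> + L \<phi> (A \<star> \<psi>)"
    unfolding L_def D_add D_scale P D_volume D_one BA V by (simp add: scale_right_distrib)
  then show ?thesis by (simp add: D_def)
qed

lemma L_equivariant_volume:
  "volume * L \<phi> \<psi> - L \<phi> \<psi> * volume = L (volume \<star> \<phi>) \<psi> + L \<phi> (volume \<star> \<psi>)"
proof -
  have "volume * pair_sum \<phi> \<psi> = pair_sum \<phi> \<psi> * volume"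
    unfolding pair_sum_def sum_distrib_left sum_distrib_right
    by (intro sum.cong refl) (simp add: scale_mult_left scale_mult_right volume_commutes)
  then have "volume * L \<phi> \<psi> - L \<phi> \<psi> * volume = 0"
    by (simp add: L_def distrib_left distrib_right left_diff_distrib right_diff_distrib
        scale_mult_left scale_mult_right)
  moreover have "L (volume \<star> \<phi>) (volume \<star> volume \<star> \<psi>) = (- volume_sq) *C L \<phi> (volume \<star> \<psi>)"
    by (rule L_volume)
  then have "volume_sq *C (L (volume \<star> \<phi>) \<psi> + L \<phi> (volume \<star> \<psi>)) = 0"
    by (simp add: volume_volume L_scale_right scale_right_distrib)
  then have "L (volume \<star> \<phi>) \<psi> + L \<phi> (volume \<star> \<psi>) = 0"
    using volume_sq_neq_0 by simp
  ultimately show ?thesis by simp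
qed

lemma L_equivariant:
  assumes "A \<in> span lie_gens"
  shows "A * L \<phi> \<psi> - L \<phi> \<psi> * A = L (A \<star> \<phi>) \<psi> + L \<phi> (A \<star> \<psi>)"
  using assms
proof (induction rule: span_induct_alt)
  case base
  have "L 0 \<psi> = 0" "L \<phi> 0 = 0" using L_scale_left[of 0 0] L_scale_right[of _ 0 0] by auto
  then show ?case by simp
next
  case (step t u v)
  have "u * L \<phi> \<psi> - L \<phi> \<psi> * u = L (u \<star> \<phi>) \<psi> + L \<phi> (u \<star> \<psi>)"
    using step(1) L_equivariant_pair L_equivariant_volume by (auto elim!: lie_gens_cases)
  then have u: "t *C (u * L \<phi> \<psi> - L \<phi> \<psi> * u) = t *C (L (u \<star> \<phi>) \<psi> + L \<phi> (u \<star> \<psi>))"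
    by simp
  have "(t *C u + v) * L \<phi> \<psi> - L \<phi> \<psi> * (t *C u + v) =
      t *C (u * L \<phi> \<psi> - L \<phi> \<psi> * u) + (v * L \<phi> \<psi> - L \<phi> \<psi> * v)"
    by (simp add: distrib_left distrib_right scale_mult_left scale_mult_right
        scale_right_diff_distrib)
  also have "\<dots> = L ((t *C u + v) \<star> \<phi>) \<psi> + L \<phi> ((t *C u + v) \<star> \<psi>)"
    unfolding u step(2)
    by (simp add: act_add_left act_scale_left L_add_left L_add_right L_scale_left L_scale_right
        scale_right_distrib)
  finally show ?case .
qed

end

section \<open>The bracket and the Jacobi identity\<close>

context spinor_rep_10
begin

sublocale prod: vector_space_prod scale scaleS ..

definition E :: "('b \<times> 'c) set" where
  "E = span lie_gens \<times> UNIV"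

definition bracket :: "'b \<times> 'c \<Rightarrow> 'b \<times> 'c \<Rightarrow> 'b \<times> 'c" where
  "bracket P Q = (fst P * fst Q - fst Q * fst P + L (snd P) (snd Q), fst P \<star> snd Q - fst Q \<star> snd P)"

lemma L_zero_left [simp]: "L 0 \<psi> = 0"
  and L_zero_right [simp]: "L \<phi> 0 = 0"
  using L_scale_left[of 0 0 \<psi>] L_scale_right[of \<phi> 0 0] by auto

lemma L_diff_right: "L \<phi> (\<psi> - \<psi>') = L \<phi> \<psi> - L \<phi> \<psi>'"
  using L_add_right[of \<phi> "\<psi> - \<psi>'" \<psi>'] by simp

lemma bracket_in_E: "P \<in> E \<Longrightarrow> Q \<in> E \<Longrightarrow> bracket P Q \<in> E"
  unfolding E_def bracket_def by (auto intro!: span_add commutator_lie L_in_lie)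

lemma bracket_bilinear: "bilinear_on (module_prod.scale scale scaleS) E bracket"
  unfolding bilinear_on_def
proof (intro conjI ballI allI)
  fix P Q assume "P \<in> E" "Q \<in> E"
  then show "bracket P Q \<in> E" by (rule bracket_in_E)
next
  fix P Q R :: "'b \<times> 'c"
  show "bracket (P + Q) R = bracket P R + bracket Q R"
    by (simp add: bracket_def distrib_left distrib_right act_add_left act_add_right L_add_left
        algebra_simps)
  show "bracket R (P + Q) = bracket R P + bracket R Q"
    by (simp add: bracket_def distrib_left distrib_right act_add_left act_add_right L_add_right
        algebra_simps)
next
  fix t and P Q :: "'b \<times> 'c"
  show "bracket (module_prod.scale scale scaleS t P) Q = module_prod.scale scale scaleS t (bracket P Q)"
    and "bracket P (module_prod.scale scale scaleS t Q) = module_prod.scale scale scaleS t (bracket P Q)"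
    by (simp_all add: bracket_def prod.scale_def scale_mult_left scale_mult_right act_scale_left
        act_scale_right L_scale_left L_scale_right scale_right_distrib scale_right_diff_distrib
        S.scale_right_diff_distrib)
qed

lemma bracket_antisym: "bracket P Q = - bracket Q P"
  using L_antisym[of "snd P" "snd Q"] by (simp add: bracket_def)

lemma bracket_self: "bracket P P = 0"
  by (simp add: bracket_def zero_prod_def)

text \<open>The components of the identity are sorted by the number of spinors: none gives associativity, one the
  action of commutators, two the equivariance of \<open>L\<close> and three the vanishing of the jacobiator.\<close>

lemma jacobi:
  assumes "P \<in> E" "Q \<in> E" "R \<in> E"
  shows "bracket P (bracket Q R) + bracket Q (bracket R P) + bracket R (bracket P Q) = 0"
proof -
  obtain a s b t c u where PQR: "P = (a, s)" "Q = (b, t)" "R = (c, u)"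
    by (metis prod.exhaust)
  have abc: "a \<in> span lie_gens" "b \<in> span lie_gens" "c \<in> span lie_gens"
    using assms by (auto simp: E_def PQR)
  have "(a * L t u - L t u * a + L s (b \<star> u - c \<star> t)) + (b * L u s - L u s * b + L t (c \<star> s - a \<star> u))
      + (c * L s t - L s t * c + L u (a \<star> t - b \<star> s)) = 0"
    unfolding L_equivariant[OF abc(1)] L_equivariant[OF abc(2)] L_equivariant[OF abc(3)] L_diff_right
    using L_antisym[of "a \<star> t" u] L_antisym[of "b \<star> u" s] L_antisym[of "c \<star> s" t]
    by simp
  moreover have "(a * (b * c - c * b) - (b * c - c * b) * a) + (b * (c * a - a * c) - (c * a - a * c) * b)
      + (c * (a * b - b * a) - (a * b - b * a) * c) = 0"
    by (simp add: algebra_simps)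
  ultimately have 1: "fst (bracket P (bracket Q R) + bracket Q (bracket R P) + bracket R (bracket P Q)) = 0"
    by (simp add: bracket_def PQR distrib_left distrib_right add.assoc) (simp add: algebra_simps)
  have "L t u \<star> s + L u s \<star> t + L s t \<star> u = 0"
    using jacobiator_zero[of t u s] by (simp add: jacobiator_def)
  then have 2: "snd (bracket P (bracket Q R) + bracket Q (bracket R P) + bracket R (bracket P Q)) = 0"
    by (simp add: bracket_def PQR act_add_left act_diff_left act_diff_right act_mult algebra_simps)
  show ?thesis using 1 2 by (simp add: prod_eq_iff)
qed

lemma E_subspace: "module.subspace (module_prod.scale scale scaleS) E"
  unfolding E_def by (rule prod.subspace_Times) auto

lemma lie_algebra_E: "lie_algebra_on (module_prod.scale scale scaleS) E bracket"
  unfolding lie_algebra_on_def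
  using prod.p.vector_space_axioms E_subspace bracket_bilinear bracket_self jacobi by blast

section \<open>Simplicity\<close>

lemma volume_in_lie: "volume \<in> span lie_gens"
  by (rule span_base) (simp add: lie_gens_def)

lemma volume_commutes_lie:
  assumes "A \<in> span lie_gens"
  shows "volume * A = A * volume"
  using assms
proof (induction rule: span_induct_alt)
  case (step t u v)
  then have "volume * u = u * volume" using volume_commutes by (auto elim!: lie_gens_cases)
  then show ?case using step by (simp add: distrib_left distrib_right scale_mult_left scale_mult_right)
qed simp

lemma volume_act_neq_0: "\<psi> \<noteq> 0 \<Longrightarrow> volume \<star> \<psi> \<noteq> 0"
  using volume_volume[of \<psi>] volume_sq_neq_0 by auto

lemma scalar_part_recouple: "scalar_part (recouple b) = recouple_value 0 *C scalar_part b"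
proof (induction b rule: word_induct)
  case (word w)
  then show ?case
    using scalar_part_word[OF word even_N two_neq_0]
    by (cases "odd_letters w = {}") (simp_all add: recouple_word scalar_part_scale)
qed (simp_all add: recouple_add recouple_scale scalar_part_add scalar_part_scale scale_right_distrib
    mult.commute)

text \<open>Only words with odd letter set \<open>{i}\<close> contribute a scalar part after multiplication by \<open>x\<^sub>i\<close>, so this
  reads off the eigenvalue in degree \<open>1\<close>.\<close>

lemma scalar_part_X_recouple:
  assumes i: "i \<in> {1..N}"
  shows "scalar_part (X i * recouple b) = recouple_value 1 *C scalar_part (X i * b)"
proof (induction b rule: word_induct)
  case (word w)
  have w: "set (i # w) \<subseteq> {1..N}" using word i by simp
  show ?case
  proof (cases "odd_letters (i # w) = {}")
    case True
    then have "odd_letters w = {i}" by (auto split: if_splits)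
    then show ?thesis
      using word by (simp add: recouple_word scale_mult_right scalar_part_scale One_nat_def)
  next
    case False
    then have "scalar_part (X i * word w) = 0"
      using scalar_part_word[OF w even_N two_neq_0] by simp
    then show ?thesis using word by (simp add: recouple_word scale_mult_right scalar_part_scale)
  qed
qed (simp_all add: recouple_add recouple_scale distrib_left scale_mult_right scalar_part_add
    scalar_part_scale scale_right_distrib mult.commute)

lemma recouple_value_neq_0: "recouple_value 0 \<noteq> 0" "recouple_value 1 \<noteq> 0"
proof -
  have "(48 :: 'a) = 2 * 2 * 2 * 2 * 3" "(24 :: 'a) = 2 * 2 * 2 * 3" by simp_all
  then have "(48 :: 'a) \<noteq> 0" "(24 :: 'a) \<noteq> 0"
    using two_neq_0 three_neq_0 by (metis mult_eq_0_iff)+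
  then show "recouple_value 0 \<noteq> 0" "recouple_value 1 \<noteq> 0"
    by (simp_all add: recouple_value_def)
qed

text \<open>The eigenvalues in the degrees \<open>0\<close> and \<open>1\<close> are nonzero, so the scalar parts of \<open>w a\<close> and of \<open>x\<^sub>1 w a\<close>
  vanish for all even words \<open>w\<close>. Every odd word is of the form \<open>x\<^sub>1 w\<close> up to sign.\<close>

lemma eq_0_if_even_recouple_0:
  assumes "\<And>w. set w \<subseteq> {1..N} \<Longrightarrow> even (length w) \<Longrightarrow> recouple (word w * a) = 0"
  shows "a = 0"
proof (rule scalar_part_nondegenerate)
  have one: "1 \<in> {1..N}" by (simp add: N_eq_10)
  have even: "scalar_part (word w * a) = 0" "scalar_part (X 1 * (word w * a)) = 0"
    if "set w \<subseteq> {1..N}" "even (length w)" for w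
    using scalar_part_recouple[of "word w * a"] scalar_part_X_recouple[OF one, of "word w * a"]
      assms[OF that] recouple_value_neq_0 by simp_all
  fix w assume w: "set w \<subseteq> {1..N}"
  show "scalar_part (word w * a) = 0"
  proof (cases "even (length w)")
    case False
    then have "scalar_part (X 1 * (word (1 # w) * a)) = 0" using w one by (intro even) auto
    moreover have "X 1 * (word (1 # w) * a) = e 1 *C (word w * a)"
      using X_square[OF one] by (simp add: scale_mult_left flip: mult.assoc)
    moreover have "e 1 \<noteq> 0" using e_square[OF one] by auto
    ultimately show ?thesis by (simp add: scalar_part_scale)
  qed (use even w in blast)
qed

end

lemma (in vector_space) separating_functional:
  assumes "subspace U" and "v \<notin> U"
  obtains h where "Vector_Spaces.linear scale (*) h" and "h v = 1" and "\<And>u. u \<in> U \<Longrightarrow> h u = 0"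
proof -
  obtain A where A: "A \<subseteq> U" "independent A" "U \<subseteq> span A" using basis_exists[of U] by metis
  then have "span A = U" using assms(1) by (simp add: span_subspace)
  then have ind: "independent (insert v A)" using assms(2) A(2) independent_insertI by blast
  interpret pair: vector_space_pair scale "(*)" by unfold_locales (simp_all add: algebra_simps)
  obtain h where h: "Vector_Spaces.linear scale (*) h" "\<forall>x\<in>insert v A. h x = (if x = v then 1 else 0)"
    using pair.linear_independent_extend[OF ind, of "\<lambda>x. if x = v then 1 else 0"] by blast
  interpret h: Vector_Spaces.linear scale "(*)" h by (rule h(1))
  have "v \<notin> A" using A(1) assms(2) by blast
  then have "h a = 0" if "a \<in> A" for a using h(2) that by auto
  then have "h u = 0" if "u \<in> U" for u
    using h.eq_0_on_span[of A u] that \<open>span A = U\<close> by blast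
  then show ?thesis using that h by auto
qed

context spinor_rep_10
begin

text \<open>A functional killing every \<open>L \<phi> \<psi>\<close> gives an element of the algebra that is \<open>B\<close>-orthogonal to
  everything, hence zero; its coefficients are the values of the functional on the generators.\<close>

lemma L_spans_lie:
  assumes U: "subspace U" and L: "\<And>\<phi> \<psi>. L \<phi> \<psi> \<in> U"
  shows "span lie_gens \<subseteq> U"
proof -
  have "u \<in> U" if u: "u \<in> lie_gens" for u
  proof (rule ccontr)
    assume "u \<notin> U"
    then obtain h where h: "Vector_Spaces.linear scale (*) h" "h u = 1" "\<And>u. u \<in> U \<Longrightarrow> h u = 0"
      using separating_functional[OF U] by blast
    interpret h: module_hom scale "(*)" h using h(1) by (simp add: linear_iff_module_hom)
    let ?t = "\<lambda>i j. e i * e j * h (wedge j i)"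
    define H where "H = (- (1 / 2)) *C (\<Sum>i\<in>{1..N}. \<Sum>j\<in>{1..N}. ?t i j *C (X j * X i))
      + (3 * volume_sq * h volume) *C volume"
    have "B \<phi> (H \<star> \<psi>) = h (L \<phi> \<psi>)" for \<phi> \<psi>
    proof -
      have "B \<phi> ((\<Sum>i\<in>{1..N}. \<Sum>j\<in>{1..N}. ?t i j *C (X j * X i)) \<star> \<psi>)
          = h (\<Sum>i\<in>{1..N}. \<Sum>j\<in>{1..N}. (e i * e j * B \<phi> ((X j * X i) \<star> \<psi>)) *C wedge j i)"
        unfolding act_sum_left B_sum_right h.sum
        by (intro sum.cong refl) (simp add: act_scale_left B_scale_right h.scale)
      then show ?thesis
        unfolding H_def L_wedge h.add h.scale act_add_left act_scale_left B_add_right B_scale_right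
        by simp
    qed
    then have "H \<star> \<psi> = 0" for \<psi>
      using h(3) L B_nondegenerate_right[of "H \<star> \<psi>"] by simp
    then have H0: "H = 0" by (rule act_faithful)
    have part: "scalar_part (word v * H) =
        (- (1 / 2)) *C (\<Sum>i\<in>{1..N}. \<Sum>j\<in>{1..N}. ?t i j *C scalar_part (word (v @ [j, i])))
      + (3 * volume_sq * h volume) *C scalar_part (word (v @ [1..<Suc N]))" for v
    proof -
      have words: "word v * (X j * X i) = word (v @ [j, i])"
        "word v * volume = word (v @ [1..<Suc N])" for i j
        by (simp_all add: word_append volume_def del: upt_Suc)
      show ?thesis
        by (simp only: H_def distrib_left scale_mult_right sum_distrib_left words scalar_part_add
            scalar_part_scale scalar_part_sum)
    qed
    have no_pair: "odd_letters (v @ w) \<noteq> {}"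
      if "odd_letters v = {1..N}" "length w \<le> 2" for v w
    proof -
      have "card (odd_letters w) \<le> card (set w)" by (intro card_mono odd_letters_subset) simp
      also have "\<dots> \<le> 2" using card_length[of w] that(2) by simp
      finally have "odd_letters w \<noteq> {1..N}" by (auto simp: N_eq_10)
      then show ?thesis unfolding odd_letters_append that(1) by blast
    qed
    have sp: "scalar_part (word w) = (if odd_letters w = {} then word w else 0)"
      if "set w \<subseteq> {1..N}" for w
      by (rule scalar_part_word[OF that even_N two_neq_0])
    show False
      using u
    proof (cases rule: lie_gens_cases)
      case volume
      have "scalar_part (word ([1..<Suc N] @ [j, i])) = 0" if "i \<in> {1..N}" "j \<in> {1..N}" for i j
        using sp[of "[1..<Suc N] @ [j, i]"] no_pair[OF odd_letters_volume, of "[j, i]"] that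
        by (simp add: atLeastLessThanSuc_atLeastAtMost del: upt_Suc)
      then have "(\<Sum>i\<in>{1..N}. \<Sum>j\<in>{1..N}. ?t i j *C scalar_part (word ([1..<Suc N] @ [j, i]))) = 0"
        by (intro sum.neutral ballI) simp
      moreover have "scalar_part (word ([1..<Suc N] @ [1..<Suc N])) = volume_sq *C 1"
        using sp[of "[1..<Suc N] @ [1..<Suc N]"] volume_square
        by (simp add: odd_letters_append atLeastLessThanSuc_atLeastAtMost word_append volume_def del: upt_Suc)
      ultimately have "(3 * volume_sq * h volume * volume_sq) *C (1 :: 'b) = 0"
        using part[of "[1..<Suc N]"] H0 by simp
      then show False
        using three_neq_0 volume_sq_neq_0 h(2) volume by simp
    next
      case (pair a b)
      \<comment> \<open>Multiplying by \<open>x\<^sub>b x\<^sub>a\<close> isolates the two terms of \<open>H\<close> with index pair \<open>{a, b}\<close>.\<close>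
      have "scalar_part (word ([b, a] @ [1..<Suc N])) = 0"
        using sp[of "[b, a] @ [1..<Suc N]"] no_pair[OF odd_letters_volume, of "[b, a]"] pair
        by (auto simp: atLeastLessThanSuc_atLeastAtMost odd_letters_append simp del: upt_Suc)
      then have zero: "(\<Sum>i\<in>{1..N}. \<Sum>j\<in>{1..N}. ?t i j *C scalar_part (word ([b, a] @ [j, i]))) = 0"
        using part[of "[b, a]"] H0 two_neq_0 by simp
      have anti: "X b * X a = - (X a * X b)" "wedge b a = - wedge a b"
        using X_anticomm[of b a] wedge_antisym[of b a] pair by auto
      have "X a * (X a * X b) = e a *C X b"
        unfolding mult.assoc[symmetric] X_square[OF pair(1)] by (simp add: scale_mult_left)
      then have sq: "X b * (X a * (X a * X b)) = (e a * e b) *C 1"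
        using X_square[OF pair(2)] by (simp add: scale_mult_right)
      have sq': "X b * (X a * (X b * X a)) = - ((e a * e b) *C 1)"
        unfolding anti(1) mult_minus_right sq ..
      have ee: "e a * (e b * (e a * (e b * t))) = t" for t
        using e_square[OF pair(1)] e_square[OF pair(2)] by (metis mult.left_commute mult.assoc mult_1)
      have summand: "?t i j *C scalar_part (word ([b, a] @ [j, i])) =
          (if i = b then if j = a then h (wedge a b) *C 1 else 0 else 0)
        + (if i = a then if j = b then h (wedge a b) *C 1 else 0 else 0)"
        if ij: "i \<in> {1..N}" "j \<in> {1..N}" for i j
      proof -
        have w: "scalar_part (word ([b, a] @ [j, i])) =
            (if odd_letters [b, a, j, i] = {} then X b * (X a * (X j * X i)) else 0)"
          using sp[of "[b, a] @ [j, i]"] pair ij by simp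
        consider "i = j" | "i = b" "j = a" | "i = a" "j = b"
          | "i \<noteq> j" "\<not> (i = b \<and> j = a)" "\<not> (i = a \<and> j = b)" by blast
        then show ?thesis
        proof cases
          case 1
          then have "wedge j i = 0" using wedge_self[OF ij(1)] by simp
          moreover have "\<not> (i = b \<and> j = a)" "\<not> (i = a \<and> j = b)" using 1 pair(3) by blast+
          ultimately show ?thesis by (simp add: h.zero)
        next
          case 2
          have "odd_letters [b, a, a, b] = {}" by simp
          then have "scalar_part (word ([b, a] @ [j, i])) = (e a * e b) *C 1"
            using w unfolding 2 by (simp only: sq simp_thms if_True)
          moreover have "e b * e a * h (wedge a b) * (e a * e b) = h (wedge a b)"
            using ee[of "h (wedge a b)"] by (simp only: ac_simps)
          ultimately show ?thesis unfolding 2 scale_scale using pair(3) by simp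
        next
          case 3
          have "odd_letters [b, a, b, a] = {}" using pair(3) by auto
          then have "scalar_part (word ([b, a] @ [j, i])) = - ((e a * e b) *C 1)"
            using w unfolding 3 by (simp only: sq' simp_thms if_True)
          moreover have "e a * e b * h (wedge a b) * (e a * e b) = h (wedge a b)"
            using ee[of "h (wedge a b)"] by (simp only: ac_simps)
          ultimately show ?thesis unfolding 3 anti(2) h.neg using pair(3) by simp
        next
          case 4
          then have "odd_letters [b, a, j, i] \<noteq> {}" using pair(3) by (auto split: if_splits)
          then show ?thesis using w 4 by auto
        qed
      qed
      have "(\<Sum>i\<in>{1..N}. \<Sum>j\<in>{1..N}. ?t i j *C scalar_part (word ([b, a] @ [j, i]))) =
          (\<Sum>i\<in>{1..N}. (if i = b then h (wedge a b) *C 1 else 0) + (if i = a then h (wedge a b) *C 1 else 0))"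
      proof (rule sum.cong[OF refl])
        fix i assume i: "i \<in> {1..N}"
        have "(\<Sum>j\<in>{1..N}. ?t i j *C scalar_part (word ([b, a] @ [j, i]))) =
            (\<Sum>j\<in>{1..N}. (if i = b then if j = a then h (wedge a b) *C 1 else 0 else 0)
              + (if i = a then if j = b then h (wedge a b) *C 1 else 0 else 0))"
          by (rule sum.cong[OF refl]) (rule summand[OF i])
        then show "(\<Sum>j\<in>{1..N}. ?t i j *C scalar_part (word ([b, a] @ [j, i]))) =
            (if i = b then h (wedge a b) *C 1 else 0) + (if i = a then h (wedge a b) *C 1 else 0)"
          using pair(1-3) by (cases "i = a"; cases "i = b") (simp_all add: sum.distrib)
      qed
      also have "\<dots> = h (wedge a b) *C 1 + h (wedge a b) *C 1"
        using pair(1,2) by (simp add: sum.distrib)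
      finally have "(\<Sum>i\<in>{1..N}. \<Sum>j\<in>{1..N}. ?t i j *C scalar_part (word ([b, a] @ [j, i]))) =
          h (wedge a b) *C 1 + h (wedge a b) *C 1" .
      then have "(2 * h (wedge a b)) *C (1 :: 'b) = 0"
        using zero by (metis mult_2 scale_left_distrib)
      then show False using two_neq_0 h(2) pair by (simp add: wedge_neq)
    qed
  qed
  then show ?thesis using U by (intro span_minimal) auto
qed

text \<open>The volume element commutes with the algebra part and acts invertibly on spinors, so bracketing with
  it isolates the spinor component. If that component is zero, the algebra part acts nontrivially on
  some spinor.\<close>

lemma ideal_contains_spinor:
  assumes I: "lie_ideal_on (module_prod.scale scale scaleS) E bracket I" and "I \<noteq> {0}"
  obtains \<psi> where "\<psi> \<noteq> 0" and "(0, \<psi>) \<in> I"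
proof -
  have sub: "prod.p.subspace I" and IE: "I \<subseteq> E" and br: "\<And>P Q. P \<in> E \<Longrightarrow> Q \<in> I \<Longrightarrow> bracket P Q \<in> I"
    using I unfolding lie_ideal_on_def by auto
  have "0 \<in> I" by (rule prod.p.subspace_0[OF sub])
  then obtain P where P: "P \<in> I" "P \<noteq> 0" using assms(2) by blast
  obtain A \<psi> where "P = (A, \<psi>)" by (cases P)
  then have A: "(A, \<psi>) \<in> I" "(A, \<psi>) \<noteq> 0" using P by simp_all
  have A_lie: "A \<in> span lie_gens" using IE A(1) by (auto simp: E_def)
  show ?thesis
  proof (cases "\<psi> = 0")
    case True
    then have "A \<noteq> 0" using A by (auto simp: zero_prod_def)
    then obtain \<phi> where "A \<star> \<phi> \<noteq> 0" using act_faithful by blast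
    moreover have "bracket (0, \<phi>) (A, \<psi>) \<in> I" using A by (intro br) (simp_all add: E_def span_zero)
    ultimately show ?thesis using that[of "- (A \<star> \<phi>)"] True by (simp add: bracket_def)
  next
    case False
    have "bracket (volume, 0) (A, \<psi>) \<in> I"
      using A by (intro br) (simp_all add: E_def volume_in_lie)
    then show ?thesis
      using that[of "volume \<star> \<psi>"] volume_act_neq_0[OF False] volume_commutes_lie[OF A_lie]
      by (simp add: bracket_def)
  qed
qed

text \<open>The spinors \<open>U\<close> of the ideal are stable under even words and contain \<open>L(\<psi>, \<chi>)\<theta>\<close> for \<open>\<psi> \<in> U\<close> and
  arbitrary \<open>\<chi>\<close> and \<open>\<theta>\<close>. A functional vanishing on \<open>U\<close> therefore makes the corresponding operator vanish
  under recoupling, also after multiplication by even words.\<close>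

lemma ideal_eq_E:
  assumes I: "lie_ideal_on (module_prod.scale scale scaleS) E bracket I" and ne: "I \<noteq> {0}"
  shows "I = E"
proof -
  have sub: "prod.p.subspace I" and IE: "I \<subseteq> E" and br: "\<And>P Q. P \<in> E \<Longrightarrow> Q \<in> I \<Longrightarrow> bracket P Q \<in> I"
    using I unfolding lie_ideal_on_def by auto
  define U where "U = {\<psi>. (0, \<psi>) \<in> I}"
  define W where "W = {A. (A, 0) \<in> I}"
  have add: "P + Q \<in> I" if "P \<in> I" "Q \<in> I" for P Q
    by (rule prod.p.subspace_add[OF sub that])
  have scale: "(t *C A, t *S \<psi>) \<in> I" if "(A, \<psi>) \<in> I" for t A \<psi>
    using prod.p.subspace_scale[OF sub that, of t] by (simp add: prod.scale_def)
  have zero: "(0, 0) \<in> I" using prod.p.subspace_0[OF sub] by (simp add: zero_prod_def)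
  have U: "S.subspace U"
    unfolding S.subspace_def U_def using zero add scale[of 0] by fastforce
  have W: "subspace W"
    unfolding subspace_def W_def using zero add scale[of _ 0] by fastforce
  have act_U: "A \<star> \<psi> \<in> U" if "A \<in> span lie_gens" "\<psi> \<in> U" for A \<psi>
    using br[of "(A, 0)" "(0, \<psi>)"] that by (simp add: U_def E_def bracket_def)
  have word_U: "word w \<star> \<psi> \<in> U" if "set w \<subseteq> {1..N}" "even (length w)" "\<psi> \<in> U" for w \<psi>
    using that(1,2)
  proof (induction w rule: induct_list012)
    case (3 i j w)
    then have IH: "word w \<star> \<psi> \<in> U" and ij: "i \<in> {1..N}" "j \<in> {1..N}" by auto
    have "(X i * X j) \<star> word w \<star> \<psi> \<in> U"
    proof (cases "i = j")
      case True
      then show ?thesis using S.subspace_scale[OF U IH] X_square[OF ij(1)] by (simp add: act_scale_left)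
    next
      case False
      then have "X i * X j \<in> lie_gens" using ij unfolding lie_gens_def by blast
      then show ?thesis using act_U IH span_base by blast
    qed
    then show ?case by (simp add: act_mult)
  qed (use that in simp_all)
  have L_W: "L \<phi> \<psi> \<in> W" if "\<psi> \<in> U" for \<phi> \<psi>
    using br[of "(0, \<phi>)" "(0, \<psi>)"] that by (simp add: U_def W_def E_def bracket_def span_zero)
  have W_U: "A \<star> \<theta> \<in> U" if "A \<in> W" for A \<theta>
  proof -
    have "bracket (0, \<theta>) (A, 0) \<in> I" using that by (intro br) (simp_all add: E_def W_def span_zero)
    then have "(0, - (A \<star> \<theta>)) \<in> I" by (simp add: bracket_def)
    from scale[OF this, of "- 1"] show ?thesis by (simp add: U_def)
  qed
  obtain \<psi> where \<psi>: "\<psi> \<noteq> 0" "\<psi> \<in> U"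
    using ideal_contains_spinor[OF I ne] by (auto simp: U_def)
  have "U = UNIV"
  proof (rule ccontr)
    assume "U \<noteq> UNIV"
    then obtain \<eta> where "\<eta> \<notin> U" by blast
    then obtain h where h: "Vector_Spaces.linear scaleS (*) h" "h \<eta> = 1" "\<And>u. u \<in> U \<Longrightarrow> h u = 0"
      using S.separating_functional[OF U] by blast
    obtain a where a: "\<And>\<theta>. a \<star> \<theta> = h \<theta> *S \<psi>" using rank_one[OF h(1)] by blast
    have "recouple (word w * a) = 0" if w: "set w \<subseteq> {1..N}" "even (length w)" for w
    proof (rule act_faithful)
      fix \<theta>
      have wa: "(word w * a) \<star> \<xi> = h \<xi> *S (word w \<star> \<psi>)" for \<xi>
        by (simp add: act_mult a act_scale_right)
      have "B \<chi> (recouple (word w * a) \<star> \<theta>) = 0" for \<chi>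
      proof -
        have "L \<chi> (word w \<star> \<psi>) \<star> \<theta> \<in> U" using W_U L_W word_U w \<psi>(2) by blast
        then have "- (L (word w \<star> \<psi>) \<chi> \<star> \<theta>) \<in> U"
          using L_antisym[of \<chi> "word w \<star> \<psi>"] by (simp add: act_minus_left)
        then have "L (word w \<star> \<psi>) \<chi> \<star> \<theta> \<in> U" using S.subspace_neg[OF U] by fastforce
        then show ?thesis using h(3) L_recouple[OF h(1) wa, of \<chi> \<theta>] by simp
      qed
      then show "recouple (word w * a) \<star> \<theta> = 0" by (rule B_nondegenerate_right)
    qed
    then have "a = 0" by (rule eq_0_if_even_recouple_0)
    then show False using a[of \<eta>] h(2) \<psi>(1) by simp
  qed
  then have "span lie_gens \<subseteq> W" using L_W by (intro L_spans_lie[OF W]) auto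
  then have "(A, \<psi>) \<in> I" if "A \<in> span lie_gens" for A \<psi>
    using add[of "(A, 0)" "(0, \<psi>)"] that \<open>U = UNIV\<close> by (auto simp: U_def W_def)
  then show ?thesis using IE by (auto simp: E_def)
qed

lemma simple_E:
  assumes "\<exists>\<psi>::'c. \<psi> \<noteq> 0"
  shows "simple_lie_algebra_on (module_prod.scale scale scaleS) E bracket"
proof -
  obtain \<psi> :: 'c where "\<psi> \<noteq> 0" using assms by blast
  then have "bracket (volume, 0) (0, \<psi>) \<noteq> 0"
    using volume_act_neq_0 by (simp add: bracket_def zero_prod_def)
  moreover have "(volume, 0) \<in> E" "(0, \<psi>) \<in> E"
    using volume_in_lie by (auto simp: E_def span_zero)
  ultimately show ?thesis
    unfolding simple_lie_algebra_on_def using lie_algebra_E ideal_eq_E by blast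
qed

end

section \<open>The bracket as a sum over increasing pairs\<close>

lemma sum_square_triangle:
  fixes F :: "nat \<Rightarrow> nat \<Rightarrow> 'a::comm_monoid_add"
  shows "(\<Sum>i\<in>{1..n}. \<Sum>j\<in>{1..n}. F i j) =
    (\<Sum>j\<in>{1..n}. \<Sum>i\<in>{1..<j}. F i j + F j i) + (\<Sum>i\<in>{1..n}. F i i)"
proof (induction n)
  case (Suc n)
  have "{1..<Suc n} = {1..n}" by auto
  then have "(\<Sum>j\<in>{1..Suc n}. \<Sum>i\<in>{1..<j}. F i j + F j i) =
      (\<Sum>j\<in>{1..n}. \<Sum>i\<in>{1..<j}. F i j + F j i) + (\<Sum>i\<in>{1..n}. F i (Suc n) + F (Suc n) i)"
    by simp
  then show ?case using Suc by (simp add: sum.distrib ac_simps)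
qed simp

context spinor_rep_10
begin

lemma L_eq_increasing:
  "L \<phi> \<psi> = 2 *C ((1 / 2) *C (\<Sum>j\<in>{1..N}. \<Sum>i\<in>{1..<j}.
       (e i * e j * B \<phi> ((X j * X i) \<star> \<psi>)) *C (X i * X j)))
     + 96 *C ((1 / 2 ^ 5 * (\<Prod>i\<in>{1..N}. e i) * B \<phi> (word (rev [1..<Suc N]) \<star> \<psi>)) *C volume)"
proof -
  let ?F = "\<lambda>i j. (e i * e j * B \<phi> ((X j * X i) \<star> \<psi>)) *C wedge j i"
  let ?G = "\<lambda>i j. (e i * e j * B \<phi> ((X j * X i) \<star> \<psi>)) *C (X i * X j)"
  have F: "?F i j + ?F j i = (- (2 :: 'a)) *C ?G i j" if "j \<in> {1..N}" "i \<in> {1..<j}" for i j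
  proof -
    have ij: "i \<in> {1..N}" "i \<noteq> j" using that by auto
    have XX: "X j * X i = - (X i * X j)" by (rule X_anticomm) (use ij that in auto)
    have two: "- u - u = - ((2 :: 'a) *C u)" for u
      using scale_left_distrib[of 1 1 u] by simp
    show ?thesis
      using ij(2) two[of "?G i j"]
      by (simp add: wedge_neq XX act_minus_left B_minus_right mult.commute[of "e j"])
  qed
  have "(\<Sum>i\<in>{1..N}. \<Sum>j\<in>{1..N}. ?F i j) = (\<Sum>j\<in>{1..N}. \<Sum>i\<in>{1..<j}. ?F i j + ?F j i)"
    unfolding sum_square_triangle by (simp add: wedge_self)
  also have "\<dots> = (\<Sum>j\<in>{1..N}. \<Sum>i\<in>{1..<j}. (- (2 :: 'a)) *C ?G i j)"
    by (intro sum.cong refl F)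
  also have "\<dots> = (- (2 :: 'a)) *C (\<Sum>j\<in>{1..N}. \<Sum>i\<in>{1..<j}. ?G i j)"
    unfolding scale_sum_right ..
  finally have "(- (1 / 2)) *C (\<Sum>i\<in>{1..N}. \<Sum>j\<in>{1..N}. ?F i j) =
      (- (1 / 2) * - (2 :: 'a)) *C (\<Sum>j\<in>{1..N}. \<Sum>i\<in>{1..<j}. ?G i j)"
    by (simp only: scale_scale)
  moreover have "- (1 / 2) * - (2 :: 'a) = 2 * (1 / 2)" by simp
  ultimately have 1: "(- (1 / 2)) *C (\<Sum>i\<in>{1..N}. \<Sum>j\<in>{1..N}. ?F i j) =
      2 *C ((1 / 2) *C (\<Sum>j\<in>{1..N}. \<Sum>i\<in>{1..<j}. ?G i j))"
    by (simp only: scale_scale)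
  have "(96 :: 'a) * (1 / 2 ^ 5) = 3"
  proof -
    have "(96 :: 'a) = 3 * 2 ^ 5" by simp
    moreover have "(2 :: 'a) ^ 5 \<noteq> 0" using two_neq_0 by (rule power_not_zero)
    ultimately show ?thesis by (metis nonzero_mult_div_cancel_right times_divide_eq_right mult_1_right)
  qed
  moreover have "B \<phi> (word (rev [1..<Suc N]) \<star> \<psi>) = - B \<phi> (volume \<star> \<psi>)"
    unfolding volume_rev sign_10 by (simp add: act_minus_left B_minus_right)
  moreover have "volume_sq = - (\<Prod>i\<in>{1..N}. e i)"
    unfolding volume_sq_def sign_10 by simp
  ultimately have 2: "96 * (1 / 2 ^ 5 * (\<Prod>i\<in>{1..N}. e i) * B \<phi> (word (rev [1..<Suc N]) \<star> \<psi>))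
      = 3 * volume_sq * B \<phi> (volume \<star> \<psi>)"
    by (simp only: mult.assoc[symmetric] mult_minus_left mult_minus_right)
  show ?thesis unfolding L_wedge 1 scale_scale 2 ..
qed

end

section \<open>Dimension\<close>

context even_clifford_frame
begin

lemma span_lie_gens:
  "span lie_gens = span (monomial ` {K. K \<subseteq> {1..N} \<and> (card K = N \<or> card K = 2)})"
    (is "_ = span (monomial ` ?S)")
proof (rule span_eq[THEN iffD2], intro conjI subsetI)
  fix u assume "u \<in> lie_gens"
  then show "u \<in> span (monomial ` ?S)"
  proof (cases rule: lie_gens_cases)
    case (pair i j)
    then have "odd_letters [i, j] = {i, j}" "{i, j} \<in> ?S" by auto
    moreover have "u = monomial (odd_letters [i, j]) \<or> u = - monomial (odd_letters [i, j])"
      using word_eq_monomial[of "[i, j]"] pair by simp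
    ultimately show ?thesis by (metis (no_types, lifting) imageI span_base span_neg)
  next
    case volume
    then show ?thesis by (auto simp: volume_eq_monomial intro!: span_base imageI)
  qed
next
  fix u assume "u \<in> monomial ` ?S"
  then obtain K where K: "u = monomial K" "K \<subseteq> {1..N}" "card K = N \<or> card K = 2" by blast
  from K(3) show "u \<in> span lie_gens"
  proof
    assume "card K = N"
    then have "K = {1..N}" using K(2) by (intro card_subset_eq) auto
    then show ?thesis using K(1) by (simp add: lie_gens_def span_base flip: volume_eq_monomial)
  next
    assume "card K = 2"
    then obtain i j where ij: "K = {i, j}" "i \<noteq> j" by (auto simp: card_2_iff)
    have "word [i, j] = monomial K \<or> word [i, j] = - monomial K"
      using word_eq_monomial[of "[i, j]"] K(2) ij by simp
    moreover have "word [i, j] \<in> span lie_gens"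
      using K(2) ij by (intro span_base) (auto simp: lie_gens_def)
    ultimately show ?thesis using K(1) by (metis minus_minus span_neg)
  qed
qed

lemma dim_span_monomials:
  assumes "S \<subseteq> Pow {1..N}"
  shows "dim (span (monomial ` S)) = card S"
proof -
  have "independent (monomial ` S)"
    using independent_mono[OF independent_monomials image_mono[OF assms]] .
  then show ?thesis
    using dim_span_eq_card_independent inj_on_subset[OF inj_on_monomial assms] card_image by metis
qed

lemma dim_lie:
  assumes "N \<noteq> 2"
  shows "dim (span lie_gens) = (N choose 2) + 1"
proof -
  let ?S = "\<lambda>k. {K. K \<subseteq> {1..N} \<and> card K = k}"
  have "{K. K \<subseteq> {1..N} \<and> (card K = N \<or> card K = 2)} = ?S N \<union> ?S 2" by blast
  moreover have "card (?S N \<union> ?S 2) = card (?S N) + card (?S 2)"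
    using assms by (intro card_Un_disjoint) auto
  moreover have "?S N \<union> ?S 2 \<subseteq> Pow {1..N}" by blast
  ultimately show ?thesis
    using n_subsets[of "{1..N}"] dim_span_monomials[of "?S N \<union> ?S 2"]
    by (simp add: span_lie_gens)
qed

lemma finite_dimensional: "finite_dimensional_vector_space scale (monomial ` Pow {1..N})"
  by unfold_locales (auto simp: independent_monomials span_monomials)

end

context spinor_rep_10
begin

lemma dim_E:
  assumes "S.dim UNIV = 32"
  shows "vector_space.dim (module_prod.scale scale scaleS) E = 78"
proof -
  obtain Basis where "finite_dimensional_vector_space scaleS Basis"
    using S.finite_dimensional_if_dim_neq_0 assms by auto
  then interpret pair: finite_dimensional_vector_space_prod scale scaleS "monomial ` Pow {1..N}" Basis
    using finite_dimensional by (intro finite_dimensional_vector_space_prod.intro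
        finite_dimensional_vector_space_pair.intro vector_space_prod.intro vector_space_pair.intro)
      (simp_all add: finite_dimensional_vector_space.axioms vector_space_axioms S.vector_space_axioms)
  show ?thesis
    unfolding E_def using pair.dim_Times[of "span lie_gens" UNIV] dim_lie assms
    by (simp add: N_eq_10 choose_two)
qed

end

section \<open>Consequences of the universal description of the Clifford algebra\<close>

lemma free_eval_superset:
  assumes "vector_space sC" and "finite A" and "Poly_Mapping.keys p \<subseteq> A"
  shows "free_eval sC \<iota> p = (\<Sum>w\<in>A. sC (Poly_Mapping.lookup p w) (prod_list (map \<iota> (letters w))))"
proof -
  interpret vector_space sC by (rule assms(1))
  show ?thesis
    unfolding free_eval_def using assms(2,3)
    by (intro sum.mono_neutral_left) (auto simp: in_keys_iff)
qed

lemma free_eval_add: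
  assumes "vector_space sC"
  shows "free_eval sC \<iota> (p + q) = free_eval sC \<iota> p + free_eval sC \<iota> q"
proof -
  interpret vector_space sC by (rule assms)
  let ?A = "Poly_Mapping.keys p \<union> Poly_Mapping.keys q"
  have "free_eval sC \<iota> (p + q) = (\<Sum>w\<in>?A. sC (Poly_Mapping.lookup (p + q) w) (prod_list (map \<iota> (letters w))))"
    by (rule free_eval_superset[OF assms]) (use keys_add[of p q] in auto)
  also have "\<dots> = free_eval sC \<iota> p + free_eval sC \<iota> q"
    by (simp add: free_eval_superset[OF assms, of ?A p] free_eval_superset[OF assms, of ?A q]
        lookup_add scale_left_distrib sum.distrib)
  finally show ?thesis .
qed

lemma free_eval_diff:
  assumes "vector_space sC"
  shows "free_eval sC \<iota> (p - q) = free_eval sC \<iota> p - free_eval sC \<iota> q"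
  using free_eval_add[OF assms, of \<iota> "p - q" q] by simp

lemma free_eval_single:
  assumes "vector_space sC"
  shows "free_eval sC \<iota> (Poly_Mapping.single w t) = sC t (prod_list (map \<iota> (letters w)))"
  using free_eval_superset[OF assms, of "{w}" "Poly_Mapping.single w t"] by auto

lemma clifford_algebra_relations:
  assumes C: "is_clifford_algebra sV g sC \<iota>"
  shows clifford_add: "\<iota> (v + w) = \<iota> v + \<iota> w"
    and clifford_scale: "\<iota> (sV t v) = sC t (\<iota> v)"
    and clifford_mult: "\<iota> v * \<iota> w + \<iota> w * \<iota> v = sC (2 * g v w) 1"
proof -
  have vs: "vector_space sC" using C by (simp add: is_clifford_algebra_def assoc_algebra_def)
  then interpret vector_space sC .
  have zero: "free_eval sC \<iota> p = 0" if "p \<in> clifford_relations sV g" for p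
    using C that hull_inc[of p "clifford_relations sV g" two_sided_ideal]
    unfolding is_clifford_algebra_def by blast
  note eval = free_eval_diff[OF vs] free_eval_add[OF vs] free_eval_single[OF vs] free_gen_def
    free_const_def mult_single plus_free_monoid_def zero_free_monoid_def
  have "free_gen (v + w) - free_gen v - free_gen w \<in> clifford_relations sV g"
    unfolding clifford_relations_def by blast
  from zero[OF this] show "\<iota> (v + w) = \<iota> v + \<iota> w" by (simp add: eval algebra_simps)
  have "free_gen (sV t v) - free_const t * free_gen v \<in> clifford_relations sV g"
    unfolding clifford_relations_def by blast
  from zero[OF this] show "\<iota> (sV t v) = sC t (\<iota> v)" by (simp add: eval)
  have "free_gen v * free_gen w + free_gen w * free_gen v - free_const (2 * g v w) \<in> clifford_relations sV g"
    unfolding clifford_relations_def by blast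
  from zero[OF this] show "\<iota> v * \<iota> w + \<iota> w * \<iota> v = sC (2 * g v w) 1" by (simp add: eval)
qed

lemma clifford_span:
  assumes C: "is_clifford_algebra sV g sC \<iota>"
  shows "module.span sC (range (\<lambda>vs. prod_list (map \<iota> vs))) = UNIV"
proof -
  have vs: "vector_space sC" using C by (simp add: is_clifford_algebra_def assoc_algebra_def)
  then interpret vector_space sC .
  have "c \<in> span (range (\<lambda>vs. prod_list (map \<iota> vs)))" for c
  proof -
    obtain p where "c = free_eval sC \<iota> p"
      using C unfolding is_clifford_algebra_def by (metis surjD)
    then show ?thesis
      unfolding free_eval_def by (simp only:) (intro span_sum span_scale span_base rangeI)
  qed
  then show ?thesis by blast
qed

lemma clifford_frame_orthonormal:
  assumes C: "is_clifford_algebra sV g sC \<iota>" and two: "(2::'k::field) \<noteq> 0"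
    and "vector_space sV" and sym: "\<forall>v w. g v w = g w v" and x: "orthonormal_basis sV g N x"
    and "even N"
  shows "even_clifford_frame (sC :: 'k \<Rightarrow> 'c::ring_1 \<Rightarrow> 'c) N (\<lambda>i. \<iota> (x i)) (\<lambda>i. g (x i) (x i))"
proof -
  have alg: "assoc_algebra sC" using C by (simp add: is_clifford_algebra_def)
  then interpret vector_space sC by (simp add: assoc_algebra_def)
  interpret V: vector_space sV by (rule assms(3))
  have mult: "sC t u * v = sC t (u * v)" "u * sC t v = sC t (u * v)" for t u v
    using alg unfolding assoc_algebra_def by metis+
  note x = x[unfolded orthonormal_basis_def]
  have frame: "clifford_frame sC N (\<lambda>i. \<iota> (x i)) (\<lambda>i. g (x i) (x i))"
  proof
    fix i assume i: "i \<in> {1..N}"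
    have "sC 2 (\<iota> (x i) * \<iota> (x i)) = \<iota> (x i) * \<iota> (x i) + \<iota> (x i) * \<iota> (x i)"
      using scale_left_distrib[of 1 1 "\<iota> (x i) * \<iota> (x i)"] by simp
    also have "\<dots> = sC 2 (sC (g (x i) (x i)) 1)" by (simp add: clifford_mult[OF C])
    finally show "\<iota> (x i) * \<iota> (x i) = sC (g (x i) (x i)) 1"
      by (rule scale_left_imp_eq[OF two])
    have "g (x i) (x i) = 1 \<or> g (x i) (x i) = - 1" using x i by blast
    then show "g (x i) (x i) * g (x i) (x i) = 1" by auto
  next
    fix i j assume "i \<in> {1..N}" "j \<in> {1..N}" "i \<noteq> j"
    then have "\<iota> (x i) * \<iota> (x j) + \<iota> (x j) * \<iota> (x i) = 0"
      using x by (simp add: clifford_mult[OF C])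
    then show "\<iota> (x i) * \<iota> (x j) = - (\<iota> (x j) * \<iota> (x i))" by (simp add: eq_neg_iff_add_eq_0)
  qed (rule mult)+
  then interpret clifford_frame sC N "\<lambda>i. \<iota> (x i)" "\<lambda>i. g (x i) (x i)" .
  let ?W = "{word w |w. set w \<subseteq> {1..N}}"
  have linear: "module_hom sV sC \<iota>"
    by unfold_locales (simp_all add: clifford_add[OF C] clifford_scale[OF C])
  have gen: "\<iota> v \<in> span ((\<lambda>i. \<iota> (x i)) ` {1..N})" for v
  proof -
    have "\<iota> v \<in> \<iota> ` V.span (x ` {1..N})" using x by auto
    then show ?thesis by (simp add: module_hom.span_image[OF linear, symmetric] image_image)
  qed
  have X: "\<iota> (x i) * c \<in> span ?W" if "i \<in> {1..N}" "c \<in> span ?W" for i c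
    using that(2)
  proof (induction rule: span_induct_alt)
    case (step t u c)
    then obtain w where w: "u = word w" "set w \<subseteq> {1..N}" by blast
    then have "word (i # w) \<in> ?W" using that(1) by (intro CollectI exI[of _ "i # w"]) auto
    then have "\<iota> (x i) * u \<in> span ?W" using w by (auto intro: span_base)
    then show ?case using step by (simp add: distrib_left mult span_add span_scale)
  qed (simp add: span_zero)
  have mult_gen: "u * c \<in> span ?W" if "u \<in> span ((\<lambda>i. \<iota> (x i)) ` {1..N})" "c \<in> span ?W" for u c
    using that(1)
  proof (induction rule: span_induct_alt)
    case (step t u d)
    then have "u * c \<in> span ?W" using X[OF _ that(2)] by blast
    then show ?case using step by (simp add: distrib_right mult span_add span_scale)
  qed (simp add: span_zero)
  have "prod_list (map \<iota> vs) \<in> span ?W" for vs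
  proof (induction vs)
    case Nil
    have "word [] \<in> ?W" by (intro CollectI exI[of _ "[]"]) simp
    then have "word [] \<in> span ?W" by (rule span_base)
    then show ?case by simp
  next
    case (Cons v vs)
    then show ?case using mult_gen[OF gen] by simp
  qed
  then have "span (range (\<lambda>vs. prod_list (map \<iota> vs))) \<subseteq> span ?W"
    by (intro span_minimal) auto
  then have "span ?W = UNIV" using clifford_span[OF C] by auto
  then show ?thesis using two \<open>even N\<close> by unfold_locales
qed

section \<open>A maximal isotropic family and its duals\<close>

text \<open>The vectors \<open>f\<close> are a basis of an isotropic subspace of maximal dimension, and the \<open>d\<close> represent
  multiples of the dual functionals, extended to the whole space.\<close>

lemma isotropic_family:
  assumes "vector_space sV" and n: "witt_index sV g = n" and dim: "vector_space.dim sV UNIV \<noteq> 0"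
    and g: "bilinear_map sV sV (*) g" and x: "orthonormal_basis sV g N x"
  obtains f d where "\<And>i j. i < n \<Longrightarrow> j < n \<Longrightarrow> g (f i) (f j) = 0"
    and "\<And>i j. i < n \<Longrightarrow> j < n \<Longrightarrow> g (d i) (f j) = (if i = j then c else (0::'k::field))"
proof -
  interpret V: vector_space sV by (rule assms(1))
  obtain Basis where "finite_dimensional_vector_space sV Basis"
    using V.finite_dimensional_if_dim_neq_0[OF dim] .
  then interpret V: finite_dimensional_vector_space sV Basis .
  let ?D = "{V.dim W |W. V.subspace W \<and> (\<forall>v\<in>W. \<forall>w\<in>W. g v w = 0)}"
  have g_right: "module_hom sV (*) (g u)" and g_left: "module_hom sV (*) (\<lambda>v. g v u)" for u
    using g by (auto simp: bilinear_map_def linear_iff_module_hom)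
  have "?D \<subseteq> {..V.dim UNIV}" using V.dim_subset[of _ UNIV] by auto
  then have "finite ?D" by (rule finite_subset) simp
  moreover have "V.dim {0} \<in> ?D"
    using module_hom.zero[OF g_right] by (intro CollectI exI[of _ "{0}"]) simp
  ultimately have "n \<in> ?D" using Max_in[of ?D] n by (auto simp: witt_index_def)
  then obtain W where W: "V.dim W = n" "\<And>v w. v \<in> W \<Longrightarrow> w \<in> W \<Longrightarrow> g v w = 0" by auto
  obtain A where A: "A \<subseteq> W" "V.independent A" "card A = n"
    using V.basis_exists[of W] W(1) by metis
  have "finite A" by (rule V.finiteI_independent[OF A(2)])
  then obtain f where f: "bij_betw f {..<n} A"
    using ex_bij_betw_nat_finite[of A] A(3) by (auto simp: atLeast0LessThan)
  have fA: "f i \<in> A" if "i < n" for i using f that by (auto simp: bij_betw_def)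
  have "\<exists>d. \<forall>j<n. g d (f j) = (if i = j then c else 0)" if i: "i < n" for i
  proof -
    interpret pair: vector_space_pair sV "(*) :: 'k \<Rightarrow> _" by unfold_locales (simp_all add: algebra_simps)
    obtain h where h: "Vector_Spaces.linear sV (*) h" "\<forall>a\<in>A. h a = (if a = f i then c else 0)"
      using pair.linear_independent_extend[OF A(2), of "\<lambda>a. if a = f i then c else 0"] by blast
    \<comment> \<open>The orthonormal basis represents the functional \<open>h\<close> by a vector.\<close>
    define d where "d = (\<Sum>k\<in>{1..N}. sV (g (x k) (x k) * h (x k)) (x k))"
    have dx: "g d (x k) = h (x k)" if k: "k \<in> {1..N}" for k
    proof -
      have "g (x k) (x k) = 1 \<or> g (x k) (x k) = - 1"
        using x k by (auto simp: orthonormal_basis_def)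
      then have gkk: "g (x k) (x k) * h (x k) * g (x k) (x k) = h (x k)" by auto
      have "g d (x k) = (\<Sum>l\<in>{1..N}. g (x l) (x l) * h (x l) * g (x l) (x k))"
        by (simp add: d_def module_hom.sum[OF g_left] module_hom.scale[OF g_left])
      also have "\<dots> = (\<Sum>l\<in>{1..N}. if l = k then h (x k) else 0)"
        using x k gkk by (intro sum.cong) (auto simp: orthonormal_basis_def)
      finally show ?thesis using k by simp
    qed
    have "g d v = h v" if "v \<in> V.span (x ` {1..N})" for v
    proof (rule pair.linear_eq_on[OF _ h(1) that])
      show "Vector_Spaces.linear sV (*) (g d)" using g_right by (simp add: linear_iff_module_hom)
      show "g d b = h b" if "b \<in> x ` {1..N}" for b
        using that dx by blast
    qed
    then have "g d v = h v" for v using x by (simp add: orthonormal_basis_def)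
    moreover have "f j = f i \<longleftrightarrow> i = j" if "j < n" for j
      using f i that by (auto simp: bij_betw_def inj_on_def)
    ultimately show ?thesis using h(2) fA by (intro exI[of _ d]) auto
  qed
  then obtain d where "\<forall>i<n. \<forall>j<n. g (d i) (f j) = (if i = j then c else 0)" by metis
  then show ?thesis using that[of f d] W(2) A(1) fA by blast
qed

lemma two_three_neq_0_if_CHAR:
  assumes "CHAR('k::field) \<noteq> 2" and "CHAR('k) \<noteq> 3"
  shows "(2::'k) \<noteq> 0" and "(3::'k) \<noteq> 0"
proof -
  have one: "CHAR('k) \<noteq> 1" using of_nat_CHAR[where 'a = 'k] by (metis of_nat_1 zero_neq_one)
  show "(2::'k) \<noteq> 0"
  proof
    assume "(2::'k) = 0"
    then have "CHAR('k) dvd 2" using of_nat_eq_0_iff_char_dvd[of 2, where 'a = 'k] by simp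
    moreover have "CHAR('k) \<in> {0, 1, 2}" using dvd_imp_le[OF calculation] by auto
    ultimately show False using assms(1) one by auto
  qed
  show "(3::'k) \<noteq> 0"
  proof
    assume "(3::'k) = 0"
    then have "CHAR('k) dvd 3" using of_nat_eq_0_iff_char_dvd[of 3, where 'a = 'k] by simp
    moreover have "CHAR('k) \<in> {0, 1, 2, 3}" using dvd_imp_le[OF calculation] by auto
    ultimately show False using assms one by auto
  qed
qed

section \<open>The exceptional Lie algebra\<close>

lemma C10_plus_C2_eq:
  assumes "even_clifford_frame sC 10 (\<lambda>i. \<iota> (x i)) e"
  shows "C10_plus_C2 sC \<iota> x =
    module.span sC (even_clifford_frame.lie_gens 10 (\<lambda>i. \<iota> (x i)))"
proof -
  interpret even_clifford_frame sC 10 "\<lambda>i. \<iota> (x i)" e by (rule assms)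
  have grade: "clifford_grade sC \<iota> 5 x m = span (monomial ` {K. K \<subseteq> {1..10} \<and> card K = m})" for m
    unfolding clifford_grade_def monomial_def word_def
    by (rule arg_cong[of _ _ span]) (auto simp: image_def)
  have "{K. K \<subseteq> {1..10} \<and> (card K = 10 \<or> card K = 2)} =
      {K. K \<subseteq> {1..10::nat} \<and> card K = 10} \<union> {K. K \<subseteq> {1..10} \<and> card K = 2}" by blast
  then show ?thesis
    unfolding C10_plus_C2_def grade span_lie_gens by (simp add: image_Un span_Un)
qed

theorem proposition8p3:
  fixes sV :: "'k::field \<Rightarrow> 'v::ab_group_add \<Rightarrow> 'v"
    and sC :: "'k \<Rightarrow> 'c::ring_1 \<Rightarrow> 'c"
    and sS :: "'k \<Rightarrow> 's::ab_group_add \<Rightarrow> 's"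
    and g :: "'v \<Rightarrow> 'v \<Rightarrow> 'k"
    and \<iota> :: "'v \<Rightarrow> 'c"
    and \<rho> :: "'c \<Rightarrow> 's \<Rightarrow> 's"
    and B :: "'s \<Rightarrow> 's \<Rightarrow> 'k"
    and x :: "nat \<Rightarrow> 'v"
  assumes "CHAR('k) \<noteq> 2" and "CHAR('k) \<noteq> 3"
    and "vector_space sV" and "vector_space.dim sV UNIV = 10"
    and "bilinear_map sV sV (*) g" and "\<forall>v w. g v w = g w v" and "nondegenerate g"
    and "witt_index sV g = 5"
    and "is_clifford_algebra sV g sC \<iota>"
    and "vector_space sS" and "vector_space.dim sS UNIV = 2 ^ 5"
    and "End_iso sC sS \<rho>"
    and "spinor_norm sS \<iota> \<rho> B" and "nondegenerate B"
    and "orthonormal_basis sV g 10 x"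
  shows "vector_space.dim (module_prod.scale sC sS) (E_space sC \<iota> x) = 78 \<and>
    (\<exists>br. is_E_bracket g sC \<iota> sS \<rho> B x br \<and>
      (\<forall>br'. is_E_bracket g sC \<iota> sS \<rho> B x br' \<longrightarrow>
        (\<forall>X\<in>E_space sC \<iota> x. \<forall>Y\<in>E_space sC \<iota> x. br' X Y = br X Y)) \<and>
      simple_lie_algebra_on (module_prod.scale sC sS) (E_space sC \<iota> x) br)"
proof -
  note two = two_three_neq_0_if_CHAR(1)[OF assms(1,2)] and three = two_three_neq_0_if_CHAR(2)[OF assms(1,2)]
  note C = \<open>is_clifford_algebra sV g sC \<iota>\<close>
  let ?X = "\<lambda>i. \<iota> (x i)" and ?e = "\<lambda>i. g (x i) (x i)"
  have frame: "even_clifford_frame sC 10 ?X ?e"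
    by (rule clifford_frame_orthonormal[OF C two assms(3,6,15)]) simp
  interpret F: even_clifford_frame sC 10 ?X ?e by (rule frame)
  interpret V: vector_space sV by (rule assms(3))
  interpret S: vector_space sS by (rule assms(10))
  have Bl: "module_hom sS (*) (B \<phi>)" and Br: "module_hom sS (*) (\<lambda>\<phi>. B \<phi> \<psi>)" for \<phi> \<psi>
    using assms(13) by (auto simp: spinor_norm_def bilinear_map_def linear_iff_module_hom)
  have B_\<iota>: "B (\<rho> (\<iota> v) \<phi>) \<psi> = B \<phi> (\<rho> (\<iota> v) \<psi>)" for v \<phi> \<psi>
    using assms(13) by (simp add: spinor_norm_def)
  interpret R: spinor_rep sC 10 ?X ?e sS \<rho> B
  proof
    show "bij_betw \<rho> UNIV {f. Vector_Spaces.linear sS sS f}"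
      and "\<rho> (c + d) \<psi> = \<rho> c \<psi> + \<rho> d \<psi>" and "\<rho> (sC t c) \<psi> = sS t (\<rho> c \<psi>)"
      and "\<rho> (c * d) \<psi> = \<rho> c (\<rho> d \<psi>)" and "\<rho> 1 \<psi> = \<psi>" for c d t \<psi>
      using assms(12) by (simp_all add: End_iso_def)
    show "B (\<phi> + \<phi>') \<psi> = B \<phi> \<psi> + B \<phi>' \<psi>" and "B \<phi> (\<psi> + \<psi>') = B \<phi> \<psi> + B \<phi> \<psi>'"
      and "B (sS t \<phi>) \<psi> = t * B \<phi> \<psi>" and "B \<phi> (sS t \<psi>) = t * B \<phi> \<psi>" for \<phi> \<phi>' \<psi> \<psi>' t
      by (rule module_hom.add[OF Br] module_hom.add[OF Bl] module_hom.scale[OF Br]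
          module_hom.scale[OF Bl])+
    show "B (\<rho> (\<iota> (x i)) \<phi>) \<psi> = B \<phi> (\<rho> (\<iota> (x i)) \<psi>)" for i \<phi> \<psi> by (rule B_\<iota>)
    show "(\<And>\<psi>. B \<phi> \<psi> = 0) \<Longrightarrow> \<phi> = 0" and "(\<And>\<phi>. B \<phi> \<psi> = 0) \<Longrightarrow> \<psi> = 0" for \<phi> \<psi>
      using assms(14) by (auto simp: nondegenerate_def)
  qed
  \<comment> \<open>The Clifford relation doubles \<open>g\<close>, so the value \<open>1 / 2\<close> makes the anticommutators equal to \<open>1\<close>.\<close>
  obtain f d where f: "\<And>i j :: nat. i < 5 \<Longrightarrow> j < 5 \<Longrightarrow> g (f i) (f j) = 0"
    and d: "\<And>i j :: nat. i < 5 \<Longrightarrow> j < 5 \<Longrightarrow> g (d i) (f j) = (if i = j then 1 / 2 else 0)"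
    using isotropic_family[OF assms(3,8) _ assms(5,15), of "1 / 2"] assms(4) by auto
  have B_sym: "B \<phi> \<psi> = B \<psi> \<phi>" for \<phi> \<psi>
  proof -
    have "B \<phi> \<psi> = (- 1) ^ (5 choose 2) * B \<psi> \<phi>"
    proof (rule R.B_symmetry[of 5 "\<lambda>i. \<iota> (f i)" "\<lambda>i. \<iota> (d i)"])
      show ff: "\<iota> (f i) * \<iota> (f j) = - (\<iota> (f j) * \<iota> (f i))" if "i < 5" "j < 5" for i j
        using clifford_mult[OF C, of "f i" "f j"] f[OF that] by (simp add: eq_neg_iff_add_eq_0)
      show "\<iota> (f i) * \<iota> (f i) = 0" if "i < 5" for i
      proof -
        have "sC 2 (\<iota> (f i) * \<iota> (f i)) = \<iota> (f i) * \<iota> (f i) + \<iota> (f i) * \<iota> (f i)"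
          using F.scale_left_distrib[of 1 1 "\<iota> (f i) * \<iota> (f i)"] by simp
        also have "\<dots> = 0" using clifford_mult[OF C, of "f i" "f i"] f[OF that that] by simp
        finally show ?thesis using two by simp
      qed
      show "\<iota> (d i) * \<iota> (f j) + \<iota> (f j) * \<iota> (d i) = (if i = j then 1 else 0)" if "i < 5" "j < 5" for i j
        using clifford_mult[OF C, of "d i" "f j"] d[OF that] two by simp
    qed (use assms(11) B_\<iota> in auto)
    then show ?thesis by (simp add: choose_two)
  qed
  interpret R: spinor_rep_10 sC 10 ?X ?e sS \<rho> B
    by unfold_locales (use three B_sym in auto)
  have lie: "C10_plus_C2 sC \<iota> x = F.span (F.lie_gens)" by (rule C10_plus_C2_eq[where \<iota> = \<iota> and x = x and e = ?e]) (rule frame)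
  have E: "E_space sC \<iota> x = R.E" by (simp add: E_space_def R.E_def lie)
  have br: "is_E_bracket g sC \<iota> sS \<rho> B x R.bracket"
    unfolding is_E_bracket_def E
  proof (intro conjI ballI allI)
    show "bilinear_on (module_prod.scale sC sS) R.E R.bracket" by (rule R.bracket_bilinear)
    show "R.bracket P Q = - R.bracket Q P" for P Q by (rule R.bracket_antisym)
    show "R.bracket (A, 0) (A', 0) = (A * A' - A' * A, 0)" for A A' by (simp add: R.bracket_def)
    show "R.bracket (A, 0) (0, \<psi>) = (0, \<rho> A \<psi>)" for A \<psi> by (simp add: R.bracket_def)
    show "R.bracket (0, \<psi>\<^sub>1) (0, \<psi>\<^sub>2) =
      (sC 2 (L2_tilde g sC \<iota> \<rho> B 5 x \<psi>\<^sub>1 \<psi>\<^sub>2) + sC 96 (L_top g sC \<iota> \<rho> B 5 x \<psi>\<^sub>1 \<psi>\<^sub>2), 0)" for \<psi>\<^sub>1 \<psi>\<^sub>2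
    proof -
      have "(2::nat) * 5 = 10" "(10::nat) + 1 = Suc 10" by simp_all
      then show ?thesis
        unfolding R.bracket_def L2_tilde_def L_top_def
        by (simp only: fst_conv snd_conv R.L_eq_increasing F.word_def F.volume_def) simp
    qed
  qed
  have unique: "br' P Q = R.bracket P Q"
    if br': "is_E_bracket g sC \<iota> sS \<rho> B x br'" and PQ: "P \<in> R.E" "Q \<in> R.E" for br' P Q
  proof -
    note D = br'[unfolded is_E_bracket_def E lie]
    obtain a s b t where P: "P = (a, s)" and Q: "Q = (b, t)" by (metis prod.exhaust)
    have ab: "a \<in> F.span F.lie_gens" "b \<in> F.span F.lie_gens" using PQ by (auto simp: P Q R.E_def)
    then have mem: "(a, 0) \<in> R.E" "(0, s) \<in> R.E" "(b, 0) \<in> R.E" "(0, t) \<in> R.E" "(b, 0) + (0, t) \<in> R.E"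
      by (auto simp: R.E_def F.span_zero)
    have add: "br' (u + v) w = br' u w + br' v w" "br' w (u + v) = br' w u + br' w v"
      if "u \<in> R.E" "v \<in> R.E" "w \<in> R.E" for u v w
      using D that unfolding bilinear_on_def by blast+
    have "br' P Q = br' ((a, 0) + (0, s)) ((b, 0) + (0, t))" by (simp add: P Q)
    also have "\<dots> = br' (a, 0) (b, 0) + br' (a, 0) (0, t) + (br' (0, s) (b, 0) + br' (0, s) (0, t))"
      using mem by (subst add(1)) (simp_all add: add(2) del: add_Pair)
    also have "br' (0, s) (b, 0) = - br' (b, 0) (0, s)" using D mem by blast
    also have "br' (a, 0) (b, 0) + br' (a, 0) (0, t) + (- br' (b, 0) (0, s) + br' (0, s) (0, t))
        = R.bracket (a, 0) (b, 0) + R.bracket (a, 0) (0, t)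
          + (- R.bracket (b, 0) (0, s) + R.bracket (0, s) (0, t))"
      using D br[unfolded is_E_bracket_def E lie] ab by simp
    also have "\<dots> = R.bracket P Q" by (simp add: R.bracket_def P Q algebra_simps)
    finally show ?thesis .
  qed
  have "\<exists>\<psi>::'s. \<psi> \<noteq> 0"
  proof (rule ccontr)
    assume "\<nexists>\<psi>::'s. \<psi> \<noteq> 0"
    then have "(UNIV :: 's set) \<subseteq> S.span {}" by (auto simp: S.span_zero)
    then have "S.dim UNIV \<le> card ({} :: 's set)" by (intro S.dim_le_card) auto
    then show False using assms(11) by simp
  qed
  then have "simple_lie_algebra_on (module_prod.scale sC sS) R.E R.bracket" by (rule R.simple_E)
  moreover have "vector_space.dim (module_prod.scale sC sS) R.E = 78"
    by (rule R.dim_E) (simp add: assms(11))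
  ultimately show ?thesis unfolding E using br unique by blast
qed

end
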